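(* Let $Z$ be a (real or complex) Banach space containing an infinite-dimensional, complemented subspace with a symmetric basis (for instance, $Z$ itself may be an infinite-dimensional Banach space with a symmetric basis). Then there exists a bounded linear operator $R:Z\to Z$ such that the set $$A=\{x\in Z:\ \|R^n(x)\|\to\infty \text{ as } n\to\infty\}$$ is non-empty and nowhere dense in $Z$, and moreover, for every $x\in Z\setminus A$, some subsequence of $(R^n(x))_{n=1}^\infty$ converges weakly to $x$.
   Context: A Schauder basis $(e_i)_{i=1}^\infty$ of a Banach space $X$ is symmetric if and only if there is an equivalent norm $\|\cdot\|$ on $X$ such that $\left\|\sum_i x_ie_i\right\|=\left\|\sum_i\lambda_ix_ie_{\pi(i)}\right\|$ for every $\sum_i x_ie_i\in X$, every permutation $\pi$ of $\mathbb{N}$ and all scalars $\lambda_i$ with $|\lambda_i|=1$. A closed subspace is complemented if it is the range of a bounded linear projection. *)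

theory Defs
  imports "HOL-Analysis.Analysis"
begin

text \<open>
  The distribution has no type class of complex Banach spaces. The scalar field is therefore made
  explicit through a scaling \<open>s\<close>, which has to be compatible with the real structure of the type.
\<close>

locale banach_space_over = vector_space s
  for s :: "'k::real_normed_field \<Rightarrow> 'a::banach \<Rightarrow> 'a" +
  assumes scale_of_real: "s (of_real r) x = r *\<^sub>R x"
    and norm_scale: "norm (s c x) = norm c * norm x"

definition bounded_linear_over ::
  "('k::real_normed_field \<Rightarrow> 'a::real_normed_vector \<Rightarrow> 'a) \<Rightarrow>
   ('k \<Rightarrow> 'b::real_normed_vector \<Rightarrow> 'b) \<Rightarrow> ('a \<Rightarrow> 'b) \<Rightarrow> bool" where
  "bounded_linear_over s t f \<longleftrightarrow>
     Vector_Spaces.linear s t f \<and> (\<exists>K. \<forall>x. norm (f x) \<le> norm x * K)"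

definition infinite_dimensional :: "('k::field \<Rightarrow> 'a::ab_group_add \<Rightarrow> 'a) \<Rightarrow> 'a set \<Rightarrow> bool" where
  "infinite_dimensional s Y \<longleftrightarrow> (\<nexists>B. finite B \<and> Y \<subseteq> module.span s B)"

definition complemented_subspace ::
  "('k::real_normed_field \<Rightarrow> 'a::banach \<Rightarrow> 'a) \<Rightarrow> 'a set \<Rightarrow> bool" where
  "complemented_subspace s Y \<longleftrightarrow>
     closed Y \<and> module.subspace s Y \<and>
     (\<exists>P. bounded_linear_over s s P \<and> P \<circ> P = P \<and> range P = Y)"

definition schauder_basis_of ::
  "('k::real_normed_field \<Rightarrow> 'a::banach \<Rightarrow> 'a) \<Rightarrow> 'a set \<Rightarrow> (nat \<Rightarrow> 'a) \<Rightarrow> bool" where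
  "schauder_basis_of s Y e \<longleftrightarrow>
     range e \<subseteq> Y \<and> (\<forall>y\<in>Y. \<exists>!x. (\<lambda>i. s (x i) (e i)) sums y)"

definition equivalent_norm_on ::
  "('k::real_normed_field \<Rightarrow> 'a::banach \<Rightarrow> 'a) \<Rightarrow> 'a set \<Rightarrow> ('a \<Rightarrow> real) \<Rightarrow> bool" where
  "equivalent_norm_on s Y N \<longleftrightarrow>
     (\<forall>y\<in>Y. N y = 0 \<longleftrightarrow> y = 0) \<and>
     (\<forall>c. \<forall>y\<in>Y. N (s c y) = norm c * N y) \<and>
     (\<forall>y\<in>Y. \<forall>z\<in>Y. N (y + z) \<le> N y + N z) \<and>
     (\<exists>a>0. \<exists>b>0. \<forall>y\<in>Y. a * norm y \<le> N y \<and> N y \<le> b * norm y)"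

text \<open>
  Convergence of the permuted series is required explicitly, since \<^const>\<open>suminf\<close> is unspecified
  on divergent series.
\<close>

definition symmetric_basis_of ::
  "('k::real_normed_field \<Rightarrow> 'a::banach \<Rightarrow> 'a) \<Rightarrow> 'a set \<Rightarrow> (nat \<Rightarrow> 'a) \<Rightarrow> bool" where
  "symmetric_basis_of s Y e \<longleftrightarrow>
     schauder_basis_of s Y e \<and>
     (\<exists>N. equivalent_norm_on s Y N \<and>
        (\<forall>x \<pi> \<theta>. summable (\<lambda>i. s (x i) (e i)) \<and> bij \<pi> \<and> (\<forall>i. norm (\<theta> i) = 1) \<longrightarrow>
           summable (\<lambda>i. s (\<theta> i * x i) (e (\<pi> i))) \<and>
           N (\<Sum>i. s (x i) (e i)) = N (\<Sum>i. s (\<theta> i * x i) (e (\<pi> i)))))"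

definition nowhere_dense :: "'a::topological_space set \<Rightarrow> bool" where
  "nowhere_dense A \<longleftrightarrow> interior (closure A) = {}"

definition weakly_converges_to ::
  "('k::real_normed_field \<Rightarrow> 'a::banach \<Rightarrow> 'a) \<Rightarrow> (nat \<Rightarrow> 'a) \<Rightarrow> 'a \<Rightarrow> bool" where
  "weakly_converges_to s X l \<longleftrightarrow>
     (\<forall>f :: 'a \<Rightarrow> 'k. bounded_linear_over s (*) f \<longrightarrow> (\<lambda>n. f (X n)) \<longlonglongrightarrow> f l)"

definition escaping_set :: "('a::real_normed_vector \<Rightarrow> 'a) \<Rightarrow> 'a set" where
  "escaping_set R = {x. filterlim (\<lambda>n. norm ((R ^^ n) x)) at_top sequentially}"

lemma banach_space_over_scaleR: "banach_space_over ((*\<^sub>R) :: real \<Rightarrow> 'a::banach \<Rightarrow> 'a)"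
  by unfold_locales (simp_all add: scaleR_add_right scaleR_add_left)

lemma bounded_linear_over_scaleR:
  "bounded_linear_over (*\<^sub>R) (*\<^sub>R) f \<longleftrightarrow> bounded_linear f"
  by (simp add: bounded_linear_over_def bounded_linear_def bounded_linear_axioms_def
      linear_def [symmetric])

end

theory Submission
  imports Defs
begin

text \<open>
  The operator is \<open>R z = T z + \<alpha>(z) g + \<beta>(z) h\<close>, where \<open>T\<close> permutes the symmetric basis in finite cycles and is
  the identity on the kernel of the projection, and \<open>\<alpha>\<close>, \<open>\<beta>\<close> are the coordinate functionals of two basis vectors fixed by \<open>T\<close>.
  Since \<open>T\<close> preserves an equivalent norm on the subspace, it is power bounded, and as every basis vector is periodic,
  all vectors return under suitable powers of \<open>T\<close>. The fate of \<open>z\<close> is thus decided by \<open>\<alpha>(z) S_n g + \<beta>(z) S_n h\<close>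
  with \<open>S_n = I + T + \<dots> + T^(n-1)\<close>, that is, by the two numbers \<open>\<alpha>(z)\<close> and \<open>\<beta>(z)\<close>.

  The vectors \<open>g\<close> and \<open>h\<close> are the sums of \<open>f_j - T f_j\<close> and of \<open>\<tau>_j (f_j - T f_j)\<close>, where \<open>f_j\<close> is a flat bump on the
  \<open>j\<close>-th cycle, of norm about \<open>M_j \<rightarrow> \<infinity>\<close>. Hence \<open>S_n (r g + h)\<close> is the sum of \<open>(r + \<tau>_j) (f_j - T^n f_j)\<close>. At any
  time \<open>n\<close> some bump is displaced off itself, so that \<open>S_n g\<close> tends to infinity
  (\<open>partial_orbit_sum_g_at_top\<close>). But at the time when the cycles up to \<open>k\<close> have
  returned, only the bump of cycle \<open>k + 1\<close> is displaced noticeably, and its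
  contribution \<open>M_(k+1) |r + \<tau>_(k+1)|\<close> is small for infinitely many \<open>k\<close>, whatever \<open>r\<close> is, if the scalars \<open>\<tau>_j\<close> scan the scalar field
  finely enough (\<open>weighted_scanning_sequence\<close>, \<open>combination_returns\<close>). Therefore the escaping vectors are
  exactly those with \<open>\<beta>(z) = 0 \<noteq> \<alpha>(z)\<close>, and every other vector is recurrent, even in norm
  (\<open>rank_two_perturbation_escapes\<close>).
\<close>

section \<open>Linear maps over the scalar field\<close>

context banach_space_over
begin

lemma scaleR_conv_scale: "r *\<^sub>R x = s (of_real r) x"
  by (simp add: scale_of_real)

lemma bounded_linear_overI:
  assumes "\<And>x y. f (x + y) = f x + f y" "\<And>c x. f (s c x) = s c (f x)"
    and "\<And>x. norm (f x) \<le> K * norm x"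
  shows "bounded_linear_over s s f"
  unfolding bounded_linear_over_def Vector_Spaces.linear_iff
  using assms vector_space_axioms by (auto simp: mult.commute intro!: exI[of _ K])

lemma bounded_linear_over_functionalI:
  fixes f :: "'a \<Rightarrow> 'k"
  assumes "\<And>x y. f (x + y) = f x + f y" "\<And>c x. f (s c x) = c * f x"
    and "\<And>x. norm (f x) \<le> K * norm x"
  shows "bounded_linear_over s (*) f"
proof -
  have "vector_space ((*) :: 'k \<Rightarrow> 'k \<Rightarrow> 'k)"
    by unfold_locales (simp_all add: algebra_simps)
  then show ?thesis
    unfolding bounded_linear_over_def Vector_Spaces.linear_iff
    using assms vector_space_axioms by (auto simp: mult.commute intro!: exI[of _ K])
qed

lemma bounded_linear_over_simps:
  assumes "bounded_linear_over s t f"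
  shows "f (x + y) = f x + f y" "f (s c x) = t c (f x)"
  using assms unfolding bounded_linear_over_def Vector_Spaces.linear_iff by auto

lemma bounded_linear_if_over:
  assumes "bounded_linear_over s s f"
  shows "bounded_linear f"
proof -
  obtain K where "\<forall>x. norm (f x) \<le> norm x * K"
    using assms by (auto simp: bounded_linear_over_def)
  then show ?thesis
    by (intro bounded_linear_intro[where K = K])
      (auto simp: bounded_linear_over_simps[OF assms] scaleR_conv_scale)
qed

lemma bounded_linear_if_over_functional:
  fixes f :: "'a \<Rightarrow> 'k"
  assumes "bounded_linear_over s (*) f"
  shows "bounded_linear f"
proof -
  obtain K where "\<forall>x. norm (f x) \<le> norm x * K"
    using assms by (auto simp: bounded_linear_over_def)
  then show ?thesis
    by (intro bounded_linear_intro[where K = K])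
      (auto simp: bounded_linear_over_simps[OF assms] scaleR_conv_scale scaleR_conv_of_real)
qed

lemma bounded_linear_over_scale: "bounded_linear_over s s (s c)"
  by (rule bounded_linear_overI[where K = "norm c"])
    (auto simp: scale_right_distrib norm_scale mult.commute)

lemma funpow_linear:
  assumes "bounded_linear_over s s T"
  shows "(T ^^ n) (x + y) = (T ^^ n) x + (T ^^ n) y" "(T ^^ n) (s c x) = s c ((T ^^ n) x)"
  by (induction n) (auto simp: bounded_linear_over_simps[OF assms])

lemma tendsto_scale:
  assumes "(f \<longlongrightarrow> c) F" "(g \<longlongrightarrow> x) F"
  shows "((\<lambda>n. s (f n) (g n)) \<longlongrightarrow> s c x) F"
proof -
  have "bounded_bilinear s"
    by (rule bounded_bilinear.intro)
      (auto simp: scale_right_distrib scale_left_distrib scaleR_conv_scale norm_scale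
        scaleR_conv_of_real mult.commute intro!: exI[of _ 1])
  then show ?thesis
    using bounded_bilinear.tendsto assms by blast
qed

section \<open>Perturbing a recurrent operator by an operator of rank two\<close>

text \<open>
  The powers of \<open>R z = T z + \<alpha>(z) g + \<beta>(z) h\<close> are \<open>R^n z = T^n z + \<alpha>(z) S_n g + \<beta>(z) S_n h\<close>, where
  \<open>S_n = I + T + \<dots> + T^(n-1)\<close>, because \<open>\<alpha>\<close> and \<open>\<beta>\<close> are invariant under \<open>R\<close> as well. If \<open>\<beta>(z) = 0 \<noteq> \<alpha>(z)\<close>,
  the growth of \<open>S_n g\<close> drives \<open>z\<close> to infinity. If \<open>\<beta>(z) \<noteq> 0\<close>, then \<open>\<alpha>(z) g + \<beta>(z) h\<close> is a multiple of
  \<open>r g + h\<close> for \<open>r = \<alpha>(z) / \<beta>(z)\<close>, and the two growing terms cancel along times at which \<open>T\<close> returns.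
  The sequence of times depends on \<open>r\<close>; this is what confines escape to the hyperplane \<open>\<beta> = 0\<close>.
\<close>

lemma rank_two_perturbation_escapes:
  fixes \<alpha> \<beta> :: "'a \<Rightarrow> 'k"
  assumes T: "bounded_linear_over s s T"
    and K: "\<And>n z. norm ((T ^^ n) z) \<le> K * norm z"
    and \<alpha>: "bounded_linear_over s (*) \<alpha>" "\<And>z. \<alpha> (T z) = \<alpha> z"
    and \<beta>: "bounded_linear_over s (*) \<beta>" "\<And>z. \<beta> (T z) = \<beta> z"
    and gh: "\<alpha> g = 0" "\<beta> g = 0" "\<alpha> h = 0" "\<beta> h = 0"
    and u: "\<alpha> u = 1" "\<beta> u = 0" and v: "\<beta> v = 1"
    and growth: "filterlim (\<lambda>n. norm (\<Sum>i<n. (T ^^ i) g)) at_top sequentially"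
    and return: "\<And>r. \<exists>n. strict_mono n \<and> (\<forall>k. n k \<ge> 1) \<and> (\<forall>z. (\<lambda>k. (T ^^ n k) z) \<longlonglongrightarrow> z) \<and>
                   (\<lambda>k. \<Sum>i<n k. (T ^^ i) (s r g + h)) \<longlonglongrightarrow> 0"
  shows "\<exists>R. bounded_linear_over s s R \<and> escaping_set R \<noteq> {} \<and> nowhere_dense (escaping_set R) \<and>
           (\<forall>x. x \<notin> escaping_set R \<longrightarrow>
              (\<exists>r :: nat \<Rightarrow> nat. strict_mono r \<and> (\<forall>k. r k \<ge> 1) \<and>
                 weakly_converges_to s (\<lambda>k. (R ^^ r k) x) x))"
proof -
  define R where "R = (\<lambda>z. T z + s (\<alpha> z) g + s (\<beta> z) h)"
  define S where "S = (\<lambda>n x. \<Sum>i<n. (T ^^ i) x)"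
  note lin = bounded_linear_over_simps[OF T] bounded_linear_over_simps[OF \<alpha>(1)]
    bounded_linear_over_simps[OF \<beta>(1)]
  obtain KT K\<alpha> K\<beta> where Ks: "\<And>x. norm (T x) \<le> norm x * KT" "\<And>x. norm (\<alpha> x) \<le> norm x * K\<alpha>"
    "\<And>x. norm (\<beta> x) \<le> norm x * K\<beta>"
    using T \<alpha>(1) \<beta>(1) unfolding bounded_linear_over_def by metis
  have R: "bounded_linear_over s s R"
  proof (rule bounded_linear_overI)
    show "R (x + y) = R x + R y" for x y
      by (simp add: R_def lin scale_left_distrib)
    show "R (s c x) = s c (R x)" for c x
      by (simp add: R_def lin scale_right_distrib)
    show "norm (R x) \<le> (KT + K\<alpha> * norm g + K\<beta> * norm h) * norm x" for x
    proof -
      have "norm (R x) \<le> norm (T x) + norm (\<alpha> x) * norm g + norm (\<beta> x) * norm h"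
        unfolding R_def by (intro order.trans[OF norm_triangle_ineq] add_mono) (auto simp: norm_scale)
      also have "\<dots> \<le> norm x * KT + (norm x * K\<alpha>) * norm g + (norm x * K\<beta>) * norm h"
        by (intro add_mono mult_right_mono Ks) auto
      finally show ?thesis
        by (simp add: algebra_simps)
    qed
  qed
  have inv: "\<alpha> ((R ^^ n) z) = \<alpha> z" "\<beta> ((R ^^ n) z) = \<beta> z" for n z
    by (induction n) (simp_all add: R_def lin \<alpha>(2) \<beta>(2) gh)
  have S_Suc: "S (Suc n) x = x + T (S n x)" for n x
    unfolding S_def
    by (simp add: sum.lessThan_Suc_shift linear_sum[OF bounded_linear.linear[OF bounded_linear_if_over[OF T]]]
        del: sum.lessThan_Suc)
  have S_lin: "S n (x + y) = S n x + S n y" "S n (s c x) = s c (S n x)" for n x y c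
    by (simp_all add: S_def funpow_linear[OF T] sum.distrib scale_sum_right)
  have powers: "(R ^^ n) z = (T ^^ n) z + s (\<alpha> z) (S n g) + s (\<beta> z) (S n h)" for n z
  proof (induction n)
    case (Suc n)
    have "(R ^^ Suc n) z = T ((R ^^ n) z) + s (\<alpha> z) g + s (\<beta> z) h"
      using inv[of n z] by (simp add: R_def)
    then show ?case
      by (simp add: Suc.IH lin S_Suc scale_right_distrib)
  qed (simp add: S_def)
  have escapes: "z \<in> escaping_set R" if "\<beta> z = 0" "\<alpha> z \<noteq> 0" for z
  proof -
    have "norm ((R ^^ n) z) \<ge> - (K * norm z) + norm (\<alpha> z) * norm (S n g)" for n
    proof -
      have "norm (s (\<alpha> z) (S n g)) \<le> norm ((R ^^ n) z) + norm ((T ^^ n) z)"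
        using norm_triangle_ineq4[of "(R ^^ n) z" "(T ^^ n) z"] that by (simp add: powers)
      then show ?thesis
        using K[of n z] by (simp add: norm_scale)
    qed
    moreover have "filterlim (\<lambda>n. - (K * norm z) + norm (\<alpha> z) * norm (S n g)) at_top sequentially"
      using that growth unfolding S_def
      by (intro filterlim_tendsto_add_at_top[OF tendsto_const]
          filterlim_tendsto_pos_mult_at_top[OF tendsto_const]) auto
    ultimately show ?thesis
      unfolding escaping_set_def mem_Collect_eq
      by (blast intro: filterlim_at_top_mono always_eventually)
  qed
  have recurs: "\<exists>r :: nat \<Rightarrow> nat. strict_mono r \<and> (\<forall>k. r k \<ge> 1) \<and> (\<lambda>k. (R ^^ r k) z) \<longlonglongrightarrow> z"
    if z: "\<beta> z \<noteq> 0 \<or> \<alpha> z = 0" for z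
  proof -
    obtain n where n: "strict_mono n" "\<forall>k. n k \<ge> 1" "(\<lambda>k. (T ^^ n k) z) \<longlonglongrightarrow> z"
      "(\<lambda>k. S (n k) (s (\<alpha> z / \<beta> z) g + h)) \<longlonglongrightarrow> 0"
      using return[of "\<alpha> z / \<beta> z"] unfolding S_def by blast
    have "(R ^^ m) z = (T ^^ m) z + s (\<beta> z) (S m (s (\<alpha> z / \<beta> z) g + h))" for m
      using z by (auto simp: powers S_lin scale_right_distrib)
    then have "(\<lambda>k. (R ^^ n k) z) \<longlonglongrightarrow> z + s (\<beta> z) 0"
      by (simp only:) (intro tendsto_add n(3) tendsto_scale[OF tendsto_const n(4)])
    then show ?thesis
      using n by auto
  qed
  have "escaping_set R \<subseteq> {z. \<beta> z = 0}"
  proof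
    fix z assume z: "z \<in> escaping_set R"
    show "z \<in> {z. \<beta> z = 0}"
    proof (rule ccontr)
      assume "z \<notin> {z. \<beta> z = 0}"
      then obtain r :: "nat \<Rightarrow> nat" where r: "strict_mono r" "(\<lambda>k. (R ^^ r k) z) \<longlonglongrightarrow> z"
        using recurs by blast
      have "filterlim (\<lambda>k. norm ((R ^^ r k) z)) at_top sequentially"
        using z r(1) unfolding escaping_set_def
        by (auto intro: filterlim_compose[OF _ filterlim_subseq])
      then show False
        using tendsto_norm[OF r(2)] not_tendsto_and_filterlim_at_infinity
          filterlim_at_top_imp_at_infinity trivial_limit_sequentially by blast
    qed
  qed
  moreover have "closed {z. \<beta> z = 0}"
    using bounded_linear.continuous_on[OF bounded_linear_if_over_functional[OF \<beta>(1)] continuous_on_id, of UNIV]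
    by (intro closed_Collect_eq) (auto simp: continuous_on_const)
  ultimately have "closure (escaping_set R) \<subseteq> {z. \<beta> z = 0}"
    by (rule closure_minimal)
  moreover have "interior {z. \<beta> z = 0} = {}"
  proof (rule ccontr)
    assume "interior {z. \<beta> z = 0} \<noteq> {}"
    then obtain x e where e: "e > 0" "cball x e \<subseteq> {z. \<beta> z = 0}"
      unfolding mem_interior_cball by (auto simp: mem_interior_cball)
    have "v \<noteq> 0"
      using v bounded_linear_over_simps(2)[OF \<beta>(1), of 0 v] by auto
    define w where "w = (e / norm v) *\<^sub>R v"
    have "x + w \<in> cball x e"
      using e \<open>v \<noteq> 0\<close> by (simp add: w_def dist_norm)
    moreover have "x \<in> cball x e"
      using e by simp
    ultimately have "\<beta> (x + w) = 0" "\<beta> x = 0"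
      using subsetD[OF e(2)] by blast+
    then show False
      using e \<open>v \<noteq> 0\<close> v by (simp add: lin w_def scaleR_conv_scale)
  qed
  ultimately have "nowhere_dense (escaping_set R)"
    unfolding nowhere_dense_def using interior_mono by blast
  moreover have "u \<in> escaping_set R"
    using escapes u by simp
  moreover have "\<exists>r :: nat \<Rightarrow> nat. strict_mono r \<and> (\<forall>k. r k \<ge> 1) \<and>
                 weakly_converges_to s (\<lambda>k. (R ^^ r k) x) x" if x: "x \<notin> escaping_set R" for x
  proof -
    obtain r :: "nat \<Rightarrow> nat" where r: "strict_mono r" "\<forall>k. r k \<ge> 1" "(\<lambda>k. (R ^^ r k) x) \<longlonglongrightarrow> x"
      using recurs[of x] escapes[of x] x by blast
    have "weakly_converges_to s (\<lambda>k. (R ^^ r k) x) x"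
      unfolding weakly_converges_to_def
      using bounded_linear.tendsto[OF bounded_linear_if_over_functional r(3)] by blast
    then show ?thesis
      using r by blast
  qed
  ultimately show ?thesis
    using R by blast
qed

end

section \<open>A scalar sequence that returns quickly to every scalar\<close>

text \<open>
  The sequence runs through finite \<open>1 / (m + 1)^2\<close>-nets of the balls of radius \<open>m\<close>, in some order,
  and a point of the \<open>m\<close>-th net gets the weight \<open>m + 1\<close>. Finiteness of
  the nets makes the weights tend to infinity, and their mesh beats the weights.
\<close>

lemma weighted_scanning_sequence:
  obtains \<tau> :: "nat \<Rightarrow> 'k::{real_normed_field, heine_borel}" and M :: "nat \<Rightarrow> real"
  where "\<And>j. M j \<ge> 1" "filterlim M at_top sequentially"
    "\<And>r. \<exists>\<sigma>. strict_mono \<sigma> \<and> (\<lambda>i. M (\<sigma> i) * norm (r + \<tau> (\<sigma> i))) \<longlonglongrightarrow> 0"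
proof -
  have "\<exists>F. finite F \<and> cball (0::'k) (real m) \<subseteq> (\<Union>x\<in>F. ball x (1 / (real m + 1)\<^sup>2))" for m
    using compact_cball[of "0::'k" "real m"] unfolding compact_eq_totally_bounded
    by (auto simp: add_pos_nonneg dest!: spec[of _ "1 / (real m + 1)\<^sup>2"])
  then obtain F where F: "\<And>m. finite (F m)"
    "\<And>m. cball (0::'k) (real m) \<subseteq> (\<Union>x\<in>F m. ball x (1 / (real m + 1)\<^sup>2))"
    by metis
  define I where "I = Sigma UNIV F"
  have net: "\<exists>x\<in>F m. norm (r + x) < 1 / (real m + 1)\<^sup>2" if "norm r \<le> real m" for r :: 'k and m
  proof -
    have "- r \<in> cball 0 (real m)"
      using that by simp
    then obtain x where "x \<in> F m" "dist x (- r) < 1 / (real m + 1)\<^sup>2"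
      using subsetD[OF F(2)] unfolding UN_iff mem_ball by blast
    then show ?thesis
      by (auto simp: dist_norm add.commute)
  qed
  have "countable I"
    unfolding I_def using F(1) by (simp add: countable_finite)
  moreover have "infinite I"
  proof
    assume "finite I"
    then have "finite (fst ` I)"
      by simp
    moreover have "fst ` I = UNIV"
    proof -
      have "m \<in> fst ` I" for m
        using net[of 0 m] unfolding I_def by force
      then show ?thesis
        by auto
    qed
    ultimately show False
      by simp
  qed
  ultimately have bij: "bij_betw (from_nat_into I) UNIV I"
    by (rule bij_betw_from_nat_into)
  define \<phi> where "\<phi> = from_nat_into I"
  define \<tau> where "\<tau> = (\<lambda>j. snd (\<phi> j))"
  define M where "M = (\<lambda>j. real (fst (\<phi> j)) + 1)"
  have fin: "finite {j. M j \<le> B}" for B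
  proof (rule inj_on_finite)
    show "inj_on \<phi> {j. M j \<le> B}"
      using bij unfolding \<phi>_def bij_betw_def by (auto intro: inj_on_subset)
    show "\<phi> ` {j. M j \<le> B} \<subseteq> Sigma {..nat \<lceil>B\<rceil>} F"
    proof
      fix y assume "y \<in> \<phi> ` {j. M j \<le> B}"
      then obtain j where j: "y = \<phi> j" "M j \<le> B"
        by auto
      have "\<phi> j \<in> I"
        using bij unfolding \<phi>_def bij_betw_def by auto
      moreover have "fst (\<phi> j) \<le> nat \<lceil>B\<rceil>"
        using j(2) unfolding M_def by linarith
      ultimately show "y \<in> Sigma {..nat \<lceil>B\<rceil>} F"
        using j(1) by (auto simp: I_def)
    qed
  qed (simp add: F(1))
  show thesis
  proof
    show "M j \<ge> 1" for j
      by (simp add: M_def)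
    show "filterlim M at_top sequentially"
      unfolding filterlim_at_top
    proof
      fix B
      show "\<forall>\<^sub>F j in sequentially. B \<le> M j"
        using fin[of B] unfolding cofinite_eq_sequentially[symmetric] eventually_cofinite
        by (auto elim!: finite_subset[rotated])
    qed
    fix r :: 'k
    define m0 where "m0 = nat \<lceil>norm r\<rceil>"
    have "\<exists>j. fst (\<phi> j) = m \<and> norm (r + \<tau> j) < 1 / (M j)\<^sup>2" if "m \<ge> m0" for m
    proof -
      have "norm r \<le> real m"
        using that unfolding m0_def by linarith
      from net[OF this] obtain x where x: "x \<in> F m" "norm (r + x) < 1 / (real m + 1)\<^sup>2"
        by blast
      from this(1) have "(m, x) \<in> I"
        by (simp add: I_def)
      then obtain j where "\<phi> j = (m, x)"
        using bij unfolding \<phi>_def bij_betw_def by (metis imageE)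
      with x show ?thesis
        by (intro exI[of _ j]) (auto simp: \<tau>_def M_def)
    qed
    then obtain J where J: "\<And>m. m \<ge> m0 \<Longrightarrow> fst (\<phi> (J m)) = m"
      "\<And>m. m \<ge> m0 \<Longrightarrow> norm (r + \<tau> (J m)) < 1 / (M (J m))\<^sup>2"
      by metis
    have "inj_on J {m0..}"
      using J(1) by (metis atLeast_iff inj_onI)
    then have inf: "infinite (J ` {m0..})"
      using finite_imageD infinite_Ici by blast
    define \<sigma> where "\<sigma> = enumerate (J ` {m0..})"
    have sm: "strict_mono \<sigma>"
      unfolding \<sigma>_def using inf strict_mono_enumerate by blast
    have bound: "M (\<sigma> i) * norm (r + \<tau> (\<sigma> i)) \<le> inverse (M (\<sigma> i))" for i
    proof -
      have "\<sigma> i \<in> J ` {m0..}"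
        unfolding \<sigma>_def using inf enumerate_in_set by blast
      then have "norm (r + \<tau> (\<sigma> i)) < 1 / (M (\<sigma> i))\<^sup>2"
        using J(2) by auto
      moreover have "M (\<sigma> i) > 0"
        by (simp add: M_def add_nonneg_pos)
      ultimately show ?thesis
        by (simp add: field_simps power2_eq_square)
    qed
    have "filterlim (\<lambda>i. M (\<sigma> i)) at_top sequentially"
      using \<open>filterlim M at_top sequentially\<close> sm
      by (auto intro: filterlim_compose[OF _ filterlim_subseq])
    then have lim: "(\<lambda>i. inverse (M (\<sigma> i))) \<longlonglongrightarrow> 0"
      by (rule tendsto_inverse_0_at_top)
    have "M j \<ge> 0" for j
      by (simp add: M_def)
    then have "(\<lambda>i. M (\<sigma> i) * norm (r + \<tau> (\<sigma> i))) \<longlonglongrightarrow> 0"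
      by (intro tendsto_sandwich[OF _ _ tendsto_const lim]) (auto simp: bound)
    then show "\<exists>\<sigma>. strict_mono \<sigma> \<and> (\<lambda>i. M (\<sigma> i) * norm (r + \<tau> (\<sigma> i))) \<longlonglongrightarrow> 0"
      using sm by blast
  qed
qed

section \<open>Permutation operators of a complemented symmetric basis\<close>

locale complemented_symmetric_basis = banach_space_over s
  for s :: "'k::real_normed_field \<Rightarrow> 'a::banach \<Rightarrow> 'a" +
  fixes Y :: "'a set" and P :: "'a \<Rightarrow> 'a" and e :: "nat \<Rightarrow> 'a" and N :: "'a \<Rightarrow> real"
  assumes closed_Y: "closed Y" and subspace_Y: "subspace Y"
    and P: "bounded_linear_over s s P" and P_idem: "P (P z) = P z" and range_P: "range P = Y"
    and basis: "schauder_basis_of s Y e"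
    and N: "equivalent_norm_on s Y N"
    and N_invariant: "\<lbrakk>summable (\<lambda>i. s (x i) (e i)); bij \<pi>; \<And>i. norm (\<theta> i) = 1\<rbrakk> \<Longrightarrow>
      summable (\<lambda>i. s (\<theta> i * x i) (e (\<pi> i))) \<and>
      N (\<Sum>i. s (x i) (e i)) = N (\<Sum>i. s (\<theta> i * x i) (e (\<pi> i)))"
begin

lemmas P_simps = bounded_linear_over_simps[OF P]

lemma P_in_Y: "P z \<in> Y"
  using range_P by auto

lemma P_on_Y: "y \<in> Y \<Longrightarrow> P y = y"
  using range_P P_idem by auto

lemma e_in_Y: "e i \<in> Y"
  using basis by (auto simp: schauder_basis_of_def)

lemma P_diff: "P (x - y) = P x - P y"
  using linear_diff[OF bounded_linear.linear[OF bounded_linear_if_over[OF P]]] .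

definition coef :: "'a \<Rightarrow> nat \<Rightarrow> 'k" where
  "coef z = (THE x. (\<lambda>i. s (x i) (e i)) sums P z)"

lemma
  shows coef_sums: "(\<lambda>i. s (coef z i) (e i)) sums P z"
    and coef_eqI: "(\<lambda>i. s (x i) (e i)) sums P z \<Longrightarrow> coef z = x"
proof -
  have "\<exists>!x. (\<lambda>i. s (x i) (e i)) sums P z"
    using basis P_in_Y by (simp add: schauder_basis_of_def)
  then show "(\<lambda>i. s (coef z i) (e i)) sums P z"
    and "(\<lambda>i. s (x i) (e i)) sums P z \<Longrightarrow> coef z = x"
    unfolding coef_def by (rule theI', rule the1_equality)
qed

lemma coef_add: "coef (x + y) i = coef x i + coef y i"
proof -
  have "coef (x + y) = (\<lambda>i. coef x i + coef y i)"
    using sums_add[OF coef_sums[of x] coef_sums[of y]]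
    by (intro coef_eqI) (simp add: P_simps scale_left_distrib)
  then show ?thesis
    by simp
qed

lemma coef_scale: "coef (s c x) i = c * coef x i"
proof -
  have "coef (s c x) = (\<lambda>i. c * coef x i)"
    using bounded_linear.sums[OF bounded_linear_if_over[OF bounded_linear_over_scale] coef_sums[of x]]
    by (intro coef_eqI) (simp add: P_simps)
  then show ?thesis
    by simp
qed

lemma coef_kernel: "P w = 0 \<Longrightarrow> coef w i = 0"
  using coef_eqI[of "\<lambda>_. 0" w] by simp

lemma sums_single_coef: "(\<lambda>i. s (if i = m then c else 0) (f i)) sums s c (f m)"
proof -
  have "(\<lambda>i. s (if i = m then c else 0) (f i)) = (\<lambda>i. if i = m then s c (f i) else 0)"
    by auto
  then show ?thesis
    using sums_single[of m "\<lambda>i. s c (f i)"] by simp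
qed

lemma coef_e: "coef (e m) i = (if i = m then 1 else 0)"
proof -
  have "coef (e m) = (\<lambda>i. if i = m then 1 else 0)"
    using sums_single_coef[of m 1 e] by (intro coef_eqI) (simp add: P_on_Y e_in_Y)
  then show ?thesis
    by simp
qed

lemma e_nonzero: "e m \<noteq> 0"
proof
  assume "e m = 0"
  then have "coef (e m) m = 0"
    by (intro coef_kernel) (simp add: linear_0[OF bounded_linear.linear[OF bounded_linear_if_over[OF P]]])
  then show False
    by (simp add: coef_e)
qed

text \<open>
  For permuted expansions; the terms need not be the expansion of \<open>y\<close> in the order of the basis.
\<close>

lemma Y_limit:
  assumes "\<And>i. f i \<in> Y" "f' sums y" "\<And>i. f' i = s (x i) (f i)"
  shows "y \<in> Y"
proof (rule closed_sequentially[OF closed_Y])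
  show "(\<lambda>n. \<Sum>i<n. f' i) \<longlonglongrightarrow> y"
    using assms by (simp add: sums_def)
  show "(\<Sum>i<n. f' i) \<in> Y" for n
    using assms subspace_Y by (simp add: subspace_sum subspace_scale)
qed

text \<open>
  The isometry \<open>e_i \<mapsto> \<theta>_i e_(\<pi> i)\<close> of the symmetric norm, extended to the whole space by the identity on
  the kernel of \<open>P\<close>.
\<close>

definition permuted :: "(nat \<Rightarrow> 'k) \<Rightarrow> (nat \<Rightarrow> nat) \<Rightarrow> 'a \<Rightarrow> 'a" where
  "permuted \<theta> \<pi> z = z - P z + (\<Sum>i. s (\<theta> i * coef z i) (e (\<pi> i)))"

definition coordinate_projection :: "nat set \<Rightarrow> 'a \<Rightarrow> 'a" where
  "coordinate_projection G z = (\<Sum>i. s (if i \<in> G then coef z i else 0) (e i))"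

context
  fixes \<theta> :: "nat \<Rightarrow> 'k" and \<pi> :: "nat \<Rightarrow> nat"
  assumes \<pi>: "bij \<pi>" and \<theta>: "\<And>i. norm (\<theta> i) = 1"
begin

lemma summable_permuted: "summable (\<lambda>i. s (\<theta> i * coef z i) (e (\<pi> i)))"
  using N_invariant[where \<theta> = \<theta>, OF sums_summable[OF coef_sums] \<pi> \<theta>] by blast

lemma permuted_add: "permuted \<theta> \<pi> (x + y) = permuted \<theta> \<pi> x + permuted \<theta> \<pi> y"
  by (simp add: permuted_def P_simps coef_add scale_left_distrib distrib_left
      suminf_add[OF summable_permuted summable_permuted, symmetric])

lemma permuted_scale: "permuted \<theta> \<pi> (s c x) = s c (permuted \<theta> \<pi> x)"
proof -
  have "(\<Sum>i. s (\<theta> i * coef (s c x) i) (e (\<pi> i))) = (\<Sum>i. s c (s (\<theta> i * coef x i) (e (\<pi> i))))"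
    by (simp add: coef_scale mult_ac)
  also have "\<dots> = s c (\<Sum>i. s (\<theta> i * coef x i) (e (\<pi> i)))"
    using bounded_linear.suminf[OF bounded_linear_if_over[OF bounded_linear_over_scale] summable_permuted]
    by simp
  finally show ?thesis
    by (simp add: permuted_def P_simps scale_right_distrib scale_right_diff_distrib)
qed

lemma permuted_e: "permuted \<theta> \<pi> (e m) = s (\<theta> m) (e (\<pi> m))"
proof -
  have "(\<lambda>i. s (\<theta> i * coef (e m) i) (e (\<pi> i))) = (\<lambda>i. s (if i = m then \<theta> m else 0) (e (\<pi> i)))"
    by (auto simp: coef_e)
  then have "(\<Sum>i. s (\<theta> i * coef (e m) i) (e (\<pi> i))) = s (\<theta> m) (e (\<pi> m))"
    using sums_unique[OF sums_single_coef[of m "\<theta> m" "\<lambda>i. e (\<pi> i)"]] by simp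
  then show ?thesis
    by (simp add: permuted_def P_on_Y e_in_Y)
qed

lemma permuted_kernel: "P w = 0 \<Longrightarrow> permuted \<theta> \<pi> w = w"
  by (simp add: permuted_def coef_kernel)

end

text \<open>
  The invariant norm is equivalent to the given one, with constants that know nothing of \<open>\<theta>\<close> and \<open>\<pi>\<close>;
  hence one bound for all permutation operators.
\<close>

lemma permuted_bounded: "\<exists>K. \<forall>\<theta> \<pi> z. bij \<pi> \<longrightarrow> (\<forall>i. norm (\<theta> i) = 1) \<longrightarrow> norm (permuted \<theta> \<pi> z) \<le> K * norm z"
proof -
  have "\<exists>a>0. \<exists>b>0. \<forall>y\<in>Y. a * norm y \<le> N y \<and> N y \<le> b * norm y"
    using N unfolding equivalent_norm_on_def by (elim conjE)
  then obtain a b where ab: "a > 0" "b > 0" "\<And>y. y \<in> Y \<Longrightarrow> a * norm y \<le> N y" "\<And>y. y \<in> Y \<Longrightarrow> N y \<le> b * norm y"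
    by metis
  obtain K where K: "\<And>x. norm (P x) \<le> norm x * K"
    using P unfolding bounded_linear_over_def by blast
  have "norm (permuted \<theta> \<pi> z) \<le> (1 + K + b / a * K) * norm z"
    if \<pi>: "bij \<pi>" and \<theta>: "\<And>i. norm (\<theta> i) = 1" for \<theta> \<pi> z
  proof -
    define w where "w = (\<Sum>i. s (\<theta> i * coef z i) (e (\<pi> i)))"
    have sums: "(\<lambda>i. s (\<theta> i * coef z i) (e (\<pi> i))) sums w"
      unfolding w_def by (rule summable_sums[OF summable_permuted[OF \<pi> \<theta>]])
    have "w \<in> Y"
      by (rule Y_limit[OF _ sums]) (auto simp: e_in_Y)
    then have "a * norm w \<le> N w"
      by (rule ab)
    also have "N w = N (P z)"
      using N_invariant[where \<theta> = \<theta>, OF sums_summable[OF coef_sums[of z]] \<pi> \<theta>] sums_unique[OF coef_sums, of z]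
      by (simp add: w_def)
    also have "\<dots> \<le> b * norm (P z)"
      by (rule ab(4)[OF P_in_Y])
    also have "\<dots> \<le> b * (norm z * K)"
      using ab K by (intro mult_left_mono) auto
    finally have "norm w \<le> b / a * K * norm z"
      using ab by (simp add: field_simps)
    moreover have "norm (permuted \<theta> \<pi> z) \<le> norm z + norm (P z) + norm w"
      unfolding permuted_def w_def[symmetric]
      by (intro order.trans[OF norm_triangle_ineq] add_mono norm_triangle_ineq4) auto
    ultimately show ?thesis
      using K[of z] by (simp add: algebra_simps)
  qed
  then show ?thesis
    by blast
qed

text \<open>
  On \<open>Y\<close>, keeping the coordinates in \<open>G\<close> is the mean of the identity and of a change of signs. This
  transfers the uniform bound to coordinate projections and, with \<open>G\<close> a singleton, the
  continuity of the coordinate functionals.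
\<close>

lemma coordinate_projection_conv_permuted:
  fixes G defines "\<theta> \<equiv> \<lambda>i. if i \<in> G then 1 else - 1"
  shows "coordinate_projection G z = (1/2) *\<^sub>R (permuted \<theta> id z + z) - (z - P z)"
proof -
  have "(\<lambda>i. s (\<theta> i * coef z i) (e i) + s (coef z i) (e i)) sums (permuted \<theta> id z - (z - P z) + P z)"
    using sums_add[OF summable_sums[OF summable_permuted[of id \<theta>]] coef_sums, of z z]
    by (simp add: permuted_def \<theta>_def bij_id)
  moreover have half: "(1/2) *\<^sub>R (s (\<theta> i * coef z i) (e i) + s (coef z i) (e i))
      = s (if i \<in> G then coef z i else 0) (e i)" for i
    by (simp add: \<theta>_def scaleR_half_double)
  ultimately
  have "(\<lambda>i. s (if i \<in> G then coef z i else 0) (e i)) sums ((1/2) *\<^sub>R (permuted \<theta> id z - (z - P z) + P z))"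
    using bounded_linear.sums[OF bounded_linear_scaleR_right, of "\<lambda>i. s (\<theta> i * coef z i) (e i) + s (coef z i) (e i)" _ "1/2"]
    unfolding half by blast
  then have "coordinate_projection G z = (1/2) *\<^sub>R (permuted \<theta> id z - (z - P z) + P z)"
    unfolding coordinate_projection_def by (rule sums_unique[symmetric])
  also have "\<dots> = (1/2) *\<^sub>R (permuted \<theta> id z + z) - (z - P z)"
  proof -
    have "permuted \<theta> id z - (z - P z) + P z = (permuted \<theta> id z + z) - 2 *\<^sub>R (z - P z)"
      by (simp add: scaleR_2)
    also have "(1/2) *\<^sub>R \<dots> = (1/2) *\<^sub>R (permuted \<theta> id z + z) - (z - P z)"
      unfolding scaleR_diff_right[of _ "permuted \<theta> id z + z"] by simp
    finally show ?thesis .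
  qed
  finally show ?thesis .
qed

lemma coordinate_projection_bounded:
  "\<exists>K. \<forall>G z. norm (coordinate_projection G z) \<le> K * norm z"
proof -
  obtain KP where KP: "\<And>x. norm (P x) \<le> norm x * KP"
    using P unfolding bounded_linear_over_def by blast
  obtain K where K: "\<And>\<theta> \<pi> z. bij \<pi> \<Longrightarrow> (\<forall>i. norm (\<theta> i) = 1) \<Longrightarrow> norm (permuted \<theta> \<pi> z) \<le> K * norm z"
    using permuted_bounded by blast
  have "norm (coordinate_projection G z) \<le> (K / 2 + 3 / 2 + KP) * norm z" for G z
  proof -
    let ?w = "permuted (\<lambda>i. if i \<in> G then 1 else - 1) id z"
    have "norm (coordinate_projection G z) \<le> norm ((1/2) *\<^sub>R (?w + z)) + norm (z - P z)"
      unfolding coordinate_projection_conv_permuted by (rule norm_triangle_ineq4)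
    also have "\<dots> \<le> (norm ?w + norm z) / 2 + (norm z + norm (P z))"
      using norm_triangle_ineq[of ?w z] norm_triangle_ineq4[of z "P z"]
      by (intro add_mono) (auto simp: divide_right_mono)
    also have "\<dots> \<le> (K * norm z + norm z) / 2 + (norm z + norm z * KP)"
      using K[of id "\<lambda>i. if i \<in> G then 1 else - 1" z] KP[of z]
      by (intro add_mono divide_right_mono order.refl) auto
    finally show ?thesis
      by (simp add: algebra_simps add_divide_distrib)
  qed
  then show ?thesis
    by blast
qed

definition sym_const :: real where
  "sym_const = (SOME K. K \<ge> 1 \<and> (\<forall>\<theta> \<pi> z. bij \<pi> \<longrightarrow> (\<forall>i. norm (\<theta> i) = 1) \<longrightarrow> norm (permuted \<theta> \<pi> z) \<le> K * norm z)
     \<and> (\<forall>G z. norm (coordinate_projection G z) \<le> K * norm z))"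

lemma
  shows sym_const_ge_1: "sym_const \<ge> 1"
    and norm_permuted: "\<lbrakk>bij \<pi>; \<And>i. norm (\<theta> i) = 1\<rbrakk> \<Longrightarrow> norm (permuted \<theta> \<pi> z) \<le> sym_const * norm z"
    and norm_coordinate_projection: "norm (coordinate_projection G z) \<le> sym_const * norm z"
proof -
  obtain K1 K2 where
    K1: "\<And>\<theta> \<pi> z. bij \<pi> \<Longrightarrow> (\<forall>i. norm (\<theta> i) = 1) \<Longrightarrow> norm (permuted \<theta> \<pi> z) \<le> K1 * norm z"
    and K2: "\<And>G z. norm (coordinate_projection G z) \<le> K2 * norm z"
    using permuted_bounded coordinate_projection_bounded by blast
  have mono: "K1 * norm z \<le> max 1 (max K1 K2) * norm z" "K2 * norm z \<le> max 1 (max K1 K2) * norm z" for z :: 'a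
    by (auto intro!: mult_right_mono)
  have "\<exists>K\<ge>1. (\<forall>\<theta> \<pi> z. bij \<pi> \<longrightarrow> (\<forall>i. norm (\<theta> i) = 1) \<longrightarrow> norm (permuted \<theta> \<pi> z) \<le> K * norm z)
     \<and> (\<forall>G z. norm (coordinate_projection G z) \<le> K * norm z)"
    by (intro exI[of _ "max 1 (max K1 K2)"])
      (auto intro!: order.trans[OF K1 mono(1)] order.trans[OF K2 mono(2)])
  from someI_ex[OF this, folded sym_const_def]
  show "sym_const \<ge> 1" "\<lbrakk>bij \<pi>; \<And>i. norm (\<theta> i) = 1\<rbrakk> \<Longrightarrow> norm (permuted \<theta> \<pi> z) \<le> sym_const * norm z"
    "norm (coordinate_projection G z) \<le> sym_const * norm z"
    by auto
qed

lemma bounded_linear_over_permuted: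
  assumes "bij \<pi>" "\<And>i. norm (\<theta> i) = 1"
  shows "bounded_linear_over s s (permuted \<theta> \<pi>)"
  using permuted_add[OF assms] permuted_scale[OF assms] norm_permuted[OF assms]
  by (rule bounded_linear_overI)

lemma bounded_linear_over_coordinate_projection:
  "bounded_linear_over s s (coordinate_projection G)"
proof (rule bounded_linear_overI[OF _ _ norm_coordinate_projection])
  show "coordinate_projection G (x + y) = coordinate_projection G x + coordinate_projection G y" for x y
    unfolding coordinate_projection_conv_permuted
    by (simp add: permuted_add bij_id P_simps algebra_simps)
  show "coordinate_projection G (s c x) = s c (coordinate_projection G x)" for c x
    unfolding coordinate_projection_conv_permuted
    by (simp add: permuted_scale bij_id P_simps scale_right_diff_distrib scale_right_distrib
        scaleR_conv_scale scale_left_commute)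
qed

lemma coordinate_projection_e: "coordinate_projection G (e m) = (if m \<in> G then e m else 0)"
proof -
  have "(\<lambda>i. s (if i \<in> G then coef (e m) i else 0) (e i))
      = (\<lambda>i. s (if i = m then if m \<in> G then 1 else 0 else 0) (e i))"
    by (auto simp: coef_e)
  then show ?thesis
    using sums_unique[OF sums_single_coef[of m "if m \<in> G then 1 else 0" e]]
    by (simp add: coordinate_projection_def split: if_splits)
qed

lemma bounded_linear_over_coef: "bounded_linear_over s (*) (\<lambda>z. coef z m)"
proof (rule bounded_linear_over_functionalI[OF coef_add coef_scale])
  fix z
  have "coordinate_projection {m} z = (\<Sum>i. s (if i = m then coef z m else 0) (e i))"
    unfolding coordinate_projection_def by (rule arg_cong[of _ _ suminf]) auto
  also have "\<dots> = s (coef z m) (e m)"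
    by (rule sums_unique[OF sums_single_coef, symmetric])
  finally have "norm (coef z m) * norm (e m) \<le> sym_const * norm z"
    using norm_coordinate_projection[of "{m}" z] by (simp add: norm_scale)
  then show "norm (coef z m) \<le> (sym_const / norm (e m)) * norm z"
    using e_nonzero[of m] by (simp add: field_simps)
qed

text \<open>
  Together with the kernel of \<open>P\<close> the basis spans a dense subspace; this and the next lemma are the
  two density arguments needed later.
\<close>

lemma eq_on_basis:
  fixes A B :: "'a \<Rightarrow> 'c::real_normed_vector"
  assumes A: "bounded_linear A" and B: "bounded_linear B"
    and "\<And>c m. A (s c (e m)) = B (s c (e m))" "\<And>w. P w = 0 \<Longrightarrow> A w = B w"
  shows "A z = B z"
proof -
  have "A (P z) = B (P z)"
    using bounded_linear.sums[OF A coef_sums[of z]] bounded_linear.sums[OF B coef_sums[of z]] assms(3)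
    by (simp add: sums_unique2)
  moreover have "A (z - P z) = B (z - P z)"
    by (rule assms) (simp add: P_diff P_idem)
  ultimately show ?thesis
    by (simp add: linear_diff[OF bounded_linear.linear[OF A]] linear_diff[OF bounded_linear.linear[OF B]])
qed

lemma tendsto_identity_on_basis:
  assumes A: "\<And>k. bounded_linear_over s s (A k)" and K: "\<And>k z. norm (A k z) \<le> K * norm z"
    and lim: "\<And>m. (\<lambda>k. A k (e m)) \<longlonglongrightarrow> e m" and ker: "\<And>k w. P w = 0 \<Longrightarrow> A k w = w"
  shows "(\<lambda>k. A k z) \<longlonglongrightarrow> z"
proof -
  note lin = bounded_linear.linear[OF bounded_linear_if_over[OF A]]
  define p where "p = (\<lambda>n. \<Sum>i<n. s (coef z i) (e i))"
  have p: "p \<longlonglongrightarrow> P z"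
    using coef_sums[of z] by (simp add: sums_def p_def)
  have Ap: "(\<lambda>k. A k (p n)) \<longlonglongrightarrow> p n" for n
    unfolding p_def linear_sum[OF lin] bounded_linear_over_simps[OF A]
    by (intro tendsto_sum tendsto_scale tendsto_const lim)
  have K0: "0 \<le> K"
    using order.trans[OF norm_ge_zero K[of 0 "e 0"]] e_nonzero[of 0] by (simp add: zero_le_mult_iff)
  have "(\<lambda>k. A k (P z)) \<longlonglongrightarrow> P z"
  proof (rule LIMSEQ_I)
    fix r :: real assume r: "r > 0"
    obtain n where n: "norm (p n - P z) < r / (2 * (K + 1))"
      using LIMSEQ_D[OF p, of "r / (2 * (K + 1))"] r K0 by auto
    obtain k0 where k0: "\<And>k. k \<ge> k0 \<Longrightarrow> norm (A k (p n) - p n) < r / 2"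
      using LIMSEQ_D[OF Ap, of "r / 2"] r by auto
    have "norm (A k (P z) - P z) < r" if "k \<ge> k0" for k
    proof -
      have "A k (P z) - P z = (A k (p n) - p n) + (p n - P z) - A k (p n - P z)"
        by (simp add: linear_diff[OF lin])
      then have "norm (A k (P z) - P z) \<le> norm (A k (p n) - p n) + norm (p n - P z) + norm (A k (p n - P z))"
        by (simp only:) (intro order.trans[OF norm_triangle_ineq4] add_right_mono norm_triangle_ineq)
      also have "\<dots> < r / 2 + (K + 1) * norm (p n - P z)"
        using k0[OF that] K[of k "p n - P z"] by (simp add: algebra_simps)
      also have "\<dots> \<le> r / 2 + (K + 1) * (r / (2 * (K + 1)))"
        using n K0 by (intro add_left_mono mult_left_mono) auto
      also have "\<dots> = r"
        using K0 by (simp add: field_simps)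
      finally show ?thesis .
    qed
    then show "\<exists>no. \<forall>n\<ge>no. norm (A n (P z) - P z) < r"
      by blast
  qed
  moreover have "A k z = A k (P z) + (z - P z)" for k
    using ker[of "z - P z" k] linear_add[OF lin, of k "P z" "z - P z"] by (simp add: P_diff P_idem)
  ultimately show ?thesis
    using tendsto_add[of "\<lambda>k. A k (P z)" "P z" sequentially "\<lambda>_. z - P z" "z - P z"] by simp
qed

end

section \<open>Bumps on long cycles\<close>

text \<open>
  The basis is split into two single vectors, with indices \<open>i0\<close> and \<open>i1\<close>, and cycles with index map \<open>ix j\<close>
  and length \<open>8 L_(j+1)\<close>, on which \<open>\<pi>\<close> is the cyclic shift. Cycle \<open>j\<close> will carry a bump of norm about
  \<open>M_j\<close> and width \<open>3 L_j\<close>. The length is tuned to the width of the next bump: while \<open>3 L_j \<le> n \<le> 3 L_(j+1)\<close>,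
  the \<open>n\<close>-th shift of bump \<open>j\<close> is disjoint from the bump, so that some cycle is displaced by about
  \<open>M_j\<close> at every time. The growth condition on \<open>L\<close> makes bumps so flat that at time \<open>8 L_(k+1)\<close>, when the
  cycles up to \<open>k\<close> have returned, those after \<open>k + 1\<close> have hardly moved, even with the coefficients \<open>\<tau>_j\<close>.
\<close>

locale cyclic_blocks = complemented_symmetric_basis s Y P e N
  for s :: "'k::real_normed_field \<Rightarrow> 'a::banach \<Rightarrow> 'a" and Y P e N +
  fixes \<tau> :: "nat \<Rightarrow> 'k" and M :: "nat \<Rightarrow> real" and L :: "nat \<Rightarrow> nat"
    and \<pi> :: "nat \<Rightarrow> nat" and ix :: "nat \<Rightarrow> nat \<Rightarrow> nat" and i0 i1 :: nat
  assumes M_ge_1: "M j \<ge> 1" and M_at_top: "filterlim M at_top sequentially"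
    and scanning: "\<exists>\<sigma>. strict_mono \<sigma> \<and> (\<lambda>i. M (\<sigma> i) * norm (r + \<tau> (\<sigma> i))) \<longlonglongrightarrow> 0"
    and L_0: "M 0 * (1 + norm (\<tau> 0)) \<le> real (L 0)"
    and L_Suc: "M (Suc j) * (1 + norm (\<tau> (Suc j))) * 2 ^ Suc j * real (L j) \<le> real (L (Suc j))"
    and L_dvd_Suc: "L j dvd L (Suc j)"
    and bij_\<pi>: "bij \<pi>"
    and \<pi>_ix: "t < 8 * L (Suc j) \<Longrightarrow> \<pi> (ix j t) = ix j (Suc t mod (8 * L (Suc j)))"
    and \<pi>_fixed: "\<pi> i0 = i0" "\<pi> i1 = i1" "i0 \<noteq> i1"
    and ix_inj: "\<lbrakk>t < 8 * L (Suc j); t' < 8 * L (Suc j'); ix j t = ix j' t'\<rbrakk> \<Longrightarrow> j = j' \<and> t = t'"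
    and ix_fresh: "t < 8 * L (Suc j) \<Longrightarrow> ix j t \<noteq> i0" "t < 8 * L (Suc j) \<Longrightarrow> ix j t \<noteq> i1"
    and ix_cover: "m = i0 \<or> m = i1 \<or> (\<exists>j t. t < 8 * L (Suc j) \<and> m = ix j t)"
begin

abbreviation q :: "nat \<Rightarrow> nat" where "q j \<equiv> 8 * L (Suc j)"

abbreviation E :: "nat \<Rightarrow> nat \<Rightarrow> 'a" where "E j t \<equiv> e (ix j t)"

abbreviation T :: "'a \<Rightarrow> 'a" where "T \<equiv> permuted (\<lambda>_. 1) \<pi>"

lemma weight_pos: "M j * (1 + norm (\<tau> j)) \<ge> 1"
  using mult_mono[OF M_ge_1[of j], of 1 "1 + norm (\<tau> j)"] M_ge_1[of j] by simp

lemma L_pos: "L j \<ge> 1"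
proof (induction j)
  case 0
  have "1 \<le> real (L 0)"
    using weight_pos[of 0] L_0 by linarith
  then show ?case
    by simp
next
  case (Suc j)
  have "0 < M (Suc j) * (1 + norm (\<tau> (Suc j))) * 2 ^ Suc j * real (L j)"
    using Suc weight_pos[of "Suc j"] by (intro mult_pos_pos[OF mult_pos_pos]) auto
  then have "0 < real (L (Suc j))"
    using L_Suc[of j] by linarith
  then show ?case
    by simp
qed

lemma L_double: "2 * L j \<le> L (Suc j)"
proof -
  have "(1::real) * (2 ^ 1 * real (L j)) \<le> M (Suc j) * (1 + norm (\<tau> (Suc j))) * (2 ^ Suc j * real (L j))"
    using weight_pos[of "Suc j"]
    by (intro mult_mono power_increasing) auto
  then have "real (2 * L j) \<le> real (L (Suc j))"
    using L_Suc[of j] by (simp add: mult.assoc)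
  then show ?thesis
    by linarith
qed

lemma L_strict_mono: "strict_mono L"
  unfolding strict_mono_Suc_iff using L_double L_pos by (metis less_le_trans mult_2 less_add_same_cancel1 less_eq_Suc_le One_nat_def)

lemma L_mono: "i \<le> j \<Longrightarrow> L i \<le> L j"
  using L_strict_mono by (simp add: strict_mono_less_eq)

lemma q_strict_mono: "strict_mono q"
  using L_strict_mono by (auto simp: strict_mono_def)

lemma q_dvd: "i \<le> j \<Longrightarrow> q i dvd q j"
proof (induction j rule: dec_induct)
  case (step n)
  then show ?case
    using L_dvd_Suc[of "Suc n"] by (meson dvd_trans mult_dvd_mono dvd_refl)
qed simp

lemma weight_le: "M j * (1 + norm (\<tau> j)) / real (L j) \<le> (1 / 2) ^ j"
proof (cases j)
  case 0
  then show ?thesis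
    using L_0 L_pos[of 0] by simp
next
  case (Suc k)
  have "M (Suc k) * (1 + norm (\<tau> (Suc k))) * 2 ^ Suc k * 1
      \<le> M (Suc k) * (1 + norm (\<tau> (Suc k))) * 2 ^ Suc k * real (L k)"
    using L_pos[of k] weight_pos[of "Suc k"] by (intro mult_left_mono) auto
  also have "\<dots> \<le> real (L (Suc k))"
    by (rule L_Suc)
  finally show ?thesis
    using L_pos[of "Suc k"] unfolding Suc power_one_over by (simp add: field_simps)
qed

lemma T: "bounded_linear_over s s T"
  by (intro bounded_linear_over_permuted bij_\<pi>) auto

lemmas T_linear = bounded_linear.linear[OF bounded_linear_if_over[OF T]]

lemma T_pow_bounded_linear: "bounded_linear (T ^^ n)"
proof (induction n)
  case 0
  then show ?case
    using bounded_linear_ident by (simp add: id_def)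
next
  case (Suc n)
  then show ?case
    using bounded_linear_compose[OF bounded_linear_if_over[OF T]] by (simp add: o_def)
qed

lemmas T_pow_linear = bounded_linear.linear[OF T_pow_bounded_linear]

lemma T_e: "T (e m) = e (\<pi> m)"
  by (simp add: permuted_e bij_\<pi>)

lemma T_pow_e: "(T ^^ n) (e m) = e ((\<pi> ^^ n) m)"
  by (induction n) (simp_all add: T_e)

lemma T_pow_kernel: "P w = 0 \<Longrightarrow> (T ^^ n) w = w"
  by (induction n) (simp_all add: permuted_kernel bij_\<pi>)

text \<open>
  All powers of \<open>T\<close> are permutation operators themselves, which is why symmetry of the basis
  makes \<open>T\<close> power bounded.
\<close>

lemma norm_T_pow: "norm ((T ^^ n) z) \<le> sym_const * norm z"
proof -
  have bij: "bij (\<pi> ^^ n)"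
    by (rule bij_betw_funpow[OF bij_\<pi>])
  have "(T ^^ n) z = permuted (\<lambda>_. 1) (\<pi> ^^ n) z"
  proof (rule eq_on_basis[OF T_pow_bounded_linear])
    show "bounded_linear (permuted (\<lambda>_. 1) (\<pi> ^^ n))"
      by (intro bounded_linear_if_over bounded_linear_over_permuted bij) auto
    show "(T ^^ n) (s c (e m)) = permuted (\<lambda>_. 1) (\<pi> ^^ n) (s c (e m))" for c m
      by (simp add: funpow_linear[OF T] permuted_scale[OF bij] permuted_e[OF bij] T_pow_e)
    show "(T ^^ n) w = permuted (\<lambda>_. 1) (\<pi> ^^ n) w" if "P w = 0" for w
      using that by (simp add: T_pow_kernel permuted_kernel[OF bij])
  qed
  then show ?thesis
    using norm_permuted[OF bij] by simp
qed

lemma T_pow_E: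
  assumes "t < q j"
  shows "(T ^^ n) (E j t) = E j ((t + n) mod q j)"
proof (induction n)
  case (Suc n)
  have "(t + n) mod q j < q j"
    using assms by (intro mod_less_divisor) linarith
  then have "T (E j ((t + n) mod q j)) = E j (Suc ((t + n) mod q j) mod q j)"
    by (simp add: T_e \<pi>_ix)
  then show ?case
    using Suc by (simp add: mod_Suc_eq)
qed (use assms in simp)

text \<open>
  Both sides are continuous in \<open>z\<close> and agree on the basis; the series defining \<open>T z\<close> is not ordered as an expansion.
\<close>

lemma coef_T:
  assumes "\<pi> i = i"
  shows "coef (T z) i = coef z i"
proof (rule eq_on_basis)
  have coef: "bounded_linear (\<lambda>z. coef z i)"
    by (rule bounded_linear_if_over_functional[OF bounded_linear_over_coef])
  then show "bounded_linear (\<lambda>z. coef (T z) i)" "bounded_linear (\<lambda>z. coef z i)"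
    using bounded_linear_compose[OF coef bounded_linear_if_over[OF T]] by auto
  show "coef (T (s c (e m))) i = coef (s c (e m)) i" for c m
  proof -
    have "\<pi> m = i \<longleftrightarrow> m = i"
      using assms bij_\<pi> by (metis bij_pointE)
    then show ?thesis
      by (auto simp: bounded_linear_over_simps[OF T] coef_scale T_e coef_e)
  qed
qed (simp add: permuted_kernel bij_\<pi>)

text \<open>
  Divisibility of the lengths lets all cycles up to \<open>k\<close> return at time \<open>q k\<close>; power boundedness takes
  care of the rest.
\<close>

lemma T_pow_returns:
  assumes "\<And>k. k \<le> n k"
  shows "(\<lambda>k. (T ^^ q (n k)) z) \<longlonglongrightarrow> z"
proof (rule tendsto_identity_on_basis)
  show "bounded_linear_over s s (T ^^ q (n k))" for k
    by (intro bounded_linear_overI[OF _ _ norm_T_pow] funpow_linear[OF T])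
  show "norm ((T ^^ q (n k)) z) \<le> sym_const * norm z" for k z
    by (rule norm_T_pow)
  show "(T ^^ q (n k)) w = w" if "P w = 0" for k w
    using that by (rule T_pow_kernel)
  show "(\<lambda>k. (T ^^ q (n k)) (e m)) \<longlonglongrightarrow> e m" for m
  proof (rule tendsto_eventually)
    consider "\<pi> m = m" | j t where "t < q j" "m = ix j t"
      using ix_cover[of m] \<pi>_fixed by blast
    then show "\<forall>\<^sub>F k in sequentially. (T ^^ q (n k)) (e m) = e m"
    proof cases
      case 1
      then have "(\<pi> ^^ i) m = m" for i
        by (induction i) auto
      then show ?thesis
        by (simp add: T_pow_e)
    next
      case 2
      have "(T ^^ q (n k)) (e m) = e m" if k: "k \<ge> j" for k
      proof -
        have "(t + q (n k)) mod q j = t mod q j"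
          using q_dvd[OF order.trans[OF k assms]] by (metis add.right_neutral dvd_imp_mod_0 mod_add_right_eq)
        then show ?thesis
          using 2 T_pow_E[OF 2(1), of "q (n k)"] by simp
      qed
      then show ?thesis
        unfolding eventually_sequentially by blast
    qed
  qed
qed

text \<open>
  A trapezoid on cycle \<open>j\<close>, written as the mean of \<open>L_j\<close> shifted windows of length \<open>2 L_j\<close>: it has slope
  \<open>1 / L_j\<close> and is constant on \<open>{L_j..<2 L_j}\<close>. It is scaled so that its restriction to the
  plateau has norm \<open>M_j\<close>. In a space such as \<open>l_1\<close> a bound from below by a single coordinate would not
  do, since the sum of the coordinates is what makes the bump large compared with its slope.
\<close>

definition window :: "nat \<Rightarrow> nat \<Rightarrow> 'a" where
  "window j t = (\<Sum>m=t..<t + 2 * L j. E j m)"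

definition plateau :: "nat \<Rightarrow> 'a" where
  "plateau j = (\<Sum>m=L j..<2 * L j. E j m)"

definition bump :: "nat \<Rightarrow> 'a" where
  "bump j = (M j / (norm (plateau j) * real (L j))) *\<^sub>R (\<Sum>t<L j. window j t)"

definition plateau_projection :: "nat \<Rightarrow> 'a \<Rightarrow> 'a" where
  "plateau_projection j = coordinate_projection (ix j ` {L j..<2 * L j})"

lemma plateau_projection_bounded_linear: "bounded_linear (plateau_projection j)"
  unfolding plateau_projection_def
  by (rule bounded_linear_if_over[OF bounded_linear_over_coordinate_projection])

lemmas plateau_projection_linear = bounded_linear.linear[OF plateau_projection_bounded_linear]

lemma q_large: "3 * L j < q j"
  using L_double[of j] L_pos[of j] by linarith

lemma plateau_projection_E:
  assumes "t < q i"
  shows "plateau_projection j (E i t) = (if i = j \<and> t \<in> {L j..<2 * L j} then E j t else 0)"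
proof -
  have "ix i t \<in> ix j ` {L j..<2 * L j} \<longleftrightarrow> i = j \<and> t \<in> {L j..<2 * L j}"
  proof
    assume "ix i t \<in> ix j ` {L j..<2 * L j}"
    then obtain m where m: "ix i t = ix j m" "m \<in> {L j..<2 * L j}"
      by (elim imageE)
    moreover have "m < q j"
      using m(2) q_large[of j] by simp
    ultimately show "i = j \<and> t \<in> {L j..<2 * L j}"
      using ix_inj[OF assms] by blast
  qed blast
  then show ?thesis
    by (simp add: plateau_projection_def coordinate_projection_e)
qed

lemma plateau_nonzero: "plateau j \<noteq> 0"
proof
  assume "plateau j = 0"
  have lin: "linear (coordinate_projection {ix j (L j)})"
    by (rule bounded_linear.linear[OF bounded_linear_if_over[OF bounded_linear_over_coordinate_projection]])
  have "coordinate_projection {ix j (L j)} (plateau j)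
      = (\<Sum>m=L j..<2 * L j. if m = L j then E j m else 0)"
    unfolding plateau_def linear_sum[OF lin] coordinate_projection_e
  proof (rule sum.cong)
    fix m assume "m \<in> {L j..<2 * L j}"
    then show "(if ix j m \<in> {ix j (L j)} then E j m else 0) = (if m = L j then E j m else 0)"
      using ix_inj[of m j "L j" j] q_large[of j] by auto
  qed simp
  also have "\<dots> = E j (L j)"
    using L_pos[of j] by (simp add: sum.delta')
  finally show False
    using \<open>plateau j = 0\<close> linear_0[OF lin] e_nonzero by simp
qed

lemma T_pow_window:
  assumes "t \<le> L j"
  shows "(T ^^ n) (window j t) = (\<Sum>m=t..<t + 2 * L j. E j ((m + n) mod q j))"
  unfolding window_def linear_sum[OF T_pow_linear]
  using assms q_large[of j] by (intro sum.cong T_pow_E) auto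

lemma window_shift:
  assumes "t \<le> L j"
  shows "(T ^^ t) (window j 0) = window j t"
proof -
  have "(T ^^ t) (window j 0) = (\<Sum>m=0..<2 * L j. E j (m + t))"
    using assms q_large[of j] by (auto simp: T_pow_window intro!: sum.cong)
  also have "\<dots> = window j t"
    unfolding window_def using sum.shift_bounds_nat_ivl[of "E j" 0 t "2 * L j"]
    by (simp add: add.commute)
  finally show ?thesis .
qed

text \<open>
  The first half of the window at 0 is a shift of the plateau, the rest of the way around the cycle.
\<close>

lemma norm_window:
  assumes "t \<le> L j"
  shows "norm (window j t) \<le> sym_const * (1 + sym_const) * norm (plateau j)"
proof -
  have "(T ^^ (q j - L j)) (plateau j) = (\<Sum>m=L j..<2 * L j. E j ((m + (q j - L j)) mod q j))"
    unfolding plateau_def linear_sum[OF T_pow_linear]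
    using q_large[of j] by (intro sum.cong T_pow_E) auto
  also have "\<dots> = (\<Sum>m=0..<L j. E j m)"
  proof -
    have "(m + L j + (q j - L j)) mod q j = m" if "m < L j" for m
    proof -
      have "m + L j + (q j - L j) = m + q j"
        using q_large[of j] by linarith
      then show ?thesis
        using that q_large[of j] by simp
    qed
    then show ?thesis
      using sum.shift_bounds_nat_ivl[of "\<lambda>m. E j ((m + (q j - L j)) mod q j)" 0 "L j" "L j"]
      by (simp add: mult_2)
  qed
  finally have "window j 0 = (T ^^ (q j - L j)) (plateau j) + plateau j"
    unfolding window_def plateau_def by (simp add: sum.atLeastLessThan_concat)
  then have "norm (window j 0) \<le> norm ((T ^^ (q j - L j)) (plateau j)) + norm (plateau j)"
    by (simp add: norm_triangle_ineq)
  also have "\<dots> \<le> (1 + sym_const) * norm (plateau j)"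
    using norm_T_pow[of "q j - L j" "plateau j"] by (simp add: algebra_simps)
  finally have "sym_const * norm (window j 0) \<le> sym_const * ((1 + sym_const) * norm (plateau j))"
    using sym_const_ge_1 by (intro mult_left_mono) auto
  then show ?thesis
    using norm_T_pow[of t "window j 0"] by (simp add: window_shift[OF assms] mult.assoc)
qed

abbreviation bump_const :: real where "bump_const \<equiv> sym_const * (1 + sym_const)"

lemma bump_factor_nonneg: "0 \<le> M j / (norm (plateau j) * real (L j))"
  using M_ge_1[of j] by simp

lemma norm_bump: "norm (bump j) \<le> bump_const * M j"
proof -
  have "norm (\<Sum>t<L j. window j t) \<le> (\<Sum>t<L j. bump_const * norm (plateau j))"
    by (intro sum_norm_le norm_window) auto
  then have "norm (bump j) \<le> M j / (norm (plateau j) * real (L j)) * (real (L j) * (bump_const * norm (plateau j)))"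
    unfolding bump_def norm_scaleR abs_of_nonneg[OF bump_factor_nonneg]
    by (intro mult_left_mono bump_factor_nonneg) simp
  also have "\<dots> = bump_const * M j"
    using L_pos[of j] plateau_nonzero[of j] by simp
  finally show ?thesis .
qed

text \<open>
  The sum over the shifted windows telescopes; this is where the flatness of the trapezoid comes from.
\<close>

lemma norm_bump_diff: "norm (bump j - T (bump j)) \<le> 2 * bump_const * M j / real (L j)"
proof -
  have "T (window j t) = window j (Suc t)" if "t < L j" for t
    using that window_shift[of t j] window_shift[of "Suc t" j] by simp
  then have "T (\<Sum>t<L j. window j t) = (\<Sum>t<L j. window j (Suc t))"
    by (simp add: linear_sum[OF T_linear])
  then have "(\<Sum>t<L j. window j t) - T (\<Sum>t<L j. window j t) = window j 0 - window j (L j)"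
    by (simp add: sum_subtractf[symmetric] sum_lessThan_telescope')
  then have "bump j - T (bump j) = (M j / (norm (plateau j) * real (L j))) *\<^sub>R (window j 0 - window j (L j))"
    by (simp add: bump_def linear_scale[OF T_linear] scaleR_diff_right[symmetric])
  then have "norm (bump j - T (bump j)) = norm ((M j / (norm (plateau j) * real (L j))) *\<^sub>R (window j 0 - window j (L j)))"
    by (rule arg_cong)
  also have "\<dots> \<le> M j / (norm (plateau j) * real (L j)) * (2 * (bump_const * norm (plateau j)))"
    unfolding norm_scaleR abs_of_nonneg[OF bump_factor_nonneg]
    using norm_triangle_ineq4[of "window j 0" "window j (L j)"] norm_window[of 0 j] norm_window[of "L j" j]
    by (intro mult_left_mono bump_factor_nonneg) linarith
  also have "\<dots> = 2 * bump_const * M j / real (L j)"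
    using plateau_nonzero[of j] by simp
  finally show ?thesis .
qed

lemma T_pow_bump:
  "(T ^^ n) (bump j) = (M j / (norm (plateau j) * real (L j))) *\<^sub>R
     (\<Sum>t<L j. \<Sum>m=t..<t + 2 * L j. E j ((m + n) mod q j))"
  by (simp add: bump_def linear_scale[OF T_pow_linear] linear_sum[OF T_pow_linear] T_pow_window)

lemma T_pow_bump_return:
  assumes "q j dvd n"
  shows "(T ^^ n) (bump j) = bump j"
proof -
  have "(m + n) mod q j = (m + 0) mod q j" for m
    using assms by (auto elim!: dvdE)
  then show ?thesis
    using T_pow_bump[of n j] T_pow_bump[of 0 j] by simp
qed

text \<open>
  With \<open>3 L_j \<le> n \<le> q_j - 3 L_j\<close> the shifted support \<open>{n..<n + 3 L_j}\<close> neither meets the plateau nor wraps around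
  the cycle.
\<close>

lemma plateau_projection_T_pow_bump:
  assumes "i = j \<Longrightarrow> 3 * L j \<le> n \<and> n + 3 * L j \<le> q j"
  shows "plateau_projection j ((T ^^ n) (bump i)) = 0"
proof -
  have "plateau_projection j (E i ((m + n) mod q i)) = 0" if "m < 3 * L i" for m
  proof -
    have "(m + n) mod q i < q i"
      using q_large[of i] by (intro mod_less_divisor) linarith
    moreover have "(m + n) mod q i \<notin> {L j..<2 * L j}" if "i = j"
    proof -
      have "m + n < q j" "3 * L j \<le> m + n"
        using assms[OF that] \<open>m < 3 * L i\<close> that by auto
      then show ?thesis
        using that by simp
    qed
    ultimately show ?thesis
      by (auto simp: plateau_projection_E)
  qed
  then have "(\<Sum>t<L i. \<Sum>m=t..<t + 2 * L i. plateau_projection j (E i ((m + n) mod q i))) = 0"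
    by (intro sum.neutral ballI) auto
  then show ?thesis
    by (simp add: T_pow_bump linear_scale[OF plateau_projection_linear] linear_sum[OF plateau_projection_linear])
qed

lemma plateau_projection_bump: "plateau_projection j (bump j) = (M j / norm (plateau j)) *\<^sub>R plateau j"
proof -
  have "plateau_projection j (window j t) = plateau j" if "t < L j" for t
  proof -
    have "plateau_projection j (window j t)
        = (\<Sum>m=t..<t + 2 * L j. if m \<in> {L j..<2 * L j} then E j m else 0)"
      unfolding window_def linear_sum[OF plateau_projection_linear]
      using that q_large[of j] by (intro sum.cong) (auto simp: plateau_projection_E)
    also have "\<dots> = (\<Sum>m\<in>{t..<t + 2 * L j} \<inter> {L j..<2 * L j}. E j m)"
      by (rule sum.inter_restrict[symmetric]) simp
    also have "{t..<t + 2 * L j} \<inter> {L j..<2 * L j} = {L j..<2 * L j}"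
      using that by auto
    finally show ?thesis
      by (simp add: plateau_def)
  qed
  then have "plateau_projection j (bump j)
      = (M j / (norm (plateau j) * real (L j))) *\<^sub>R (\<Sum>t<L j. plateau j)"
    by (simp add: bump_def linear_scale[OF plateau_projection_linear] linear_sum[OF plateau_projection_linear])
  also have "\<dots> = (M j / norm (plateau j)) *\<^sub>R plateau j"
    using L_pos[of j] by (simp add: sum_constant_scaleR)
  finally show ?thesis .
qed

lemma coef_bump:
  assumes "i = i0 \<or> i = i1"
  shows "coef ((T ^^ n) (bump j)) i = 0"
proof -
  have lin: "linear (\<lambda>z. coef z i)"
    by (rule bounded_linear.linear[OF bounded_linear_if_over_functional[OF bounded_linear_over_coef]])
  have "coef (E j (m mod q j)) i = 0" for m
  proof -
    have "m mod q j < q j"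
      using q_large[of j] by (intro mod_less_divisor) linarith
    then show ?thesis
      using ix_fresh assms by (auto simp: coef_e)
  qed
  then show ?thesis
    by (simp add: T_pow_bump linear_scale[OF lin] linear_sum[OF lin])
qed

end

section \<open>The two perturbing vectors\<close>

context cyclic_blocks
begin

text \<open>
  The bumps themselves do not form a convergent series, but their jumps do. The sum \<open>g\<close> of the jumps thus
  behaves like \<open>f - T f\<close> for a divergent series \<open>f\<close>, and so its orbit sums can be unbounded.
\<close>

definition jump :: "nat \<Rightarrow> 'a" where
  "jump j = bump j - T (bump j)"

definition partial_orbit_sum :: "nat \<Rightarrow> 'a \<Rightarrow> 'a" where
  "partial_orbit_sum n x = (\<Sum>i<n. (T ^^ i) x)"


lemma norm_weighted_jump:
  assumes "0 \<le> a" "a \<le> 1 + norm (\<tau> j)"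
  shows "a * norm (jump j) \<le> 2 * bump_const * (1/2) ^ j"
proof -
  have B: "0 \<le> 2 * bump_const"
    using sym_const_ge_1 by simp
  have "a * norm (jump j) \<le> (1 + norm (\<tau> j)) * (2 * bump_const * M j / real (L j))"
    using assms norm_bump_diff[of j] by (intro mult_mono) (auto simp: jump_def)
  also have "\<dots> = 2 * bump_const * (M j * (1 + norm (\<tau> j)) / real (L j))"
    by simp
  also have "\<dots> \<le> 2 * bump_const * (1/2) ^ j"
    by (intro mult_left_mono weight_le B)
  finally show ?thesis .
qed

lemma norm_scaled_jump:
  assumes "norm c \<le> 1 + norm (\<tau> j)"
  shows "norm (s c (jump j)) \<le> 2 * bump_const * (1/2) ^ j"
  using norm_weighted_jump[OF norm_ge_zero assms] by (simp add: norm_scale)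

lemma summable_jump: "summable jump" "summable (\<lambda>j. s (\<tau> j) (jump j))"
proof -
  have "summable (\<lambda>j. 2 * bump_const * (1/2::real) ^ j)"
    by (intro summable_mult summable_geometric) simp
  then have scaled: "summable (\<lambda>j. s (c j) (jump j))" if "\<And>j. norm (c j) \<le> 1 + norm (\<tau> j)" for c
    by (rule summable_comparison_test') (rule norm_scaled_jump[OF that])
  show "summable jump" "summable (\<lambda>j. s (\<tau> j) (jump j))"
    using scaled[of "\<lambda>_. 1"] scaled[of \<tau>] by simp_all
qed

lemma partial_orbit_sum_linear:
  "partial_orbit_sum n (x + y) = partial_orbit_sum n x + partial_orbit_sum n y"
  "partial_orbit_sum n (s c x) = s c (partial_orbit_sum n x)"
  by (simp_all add: partial_orbit_sum_def funpow_linear[OF T] sum.distrib scale_sum_right)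

lemma norm_partial_orbit_sum: "norm (partial_orbit_sum n x) \<le> real n * sym_const * norm x"
proof -
  have "norm (partial_orbit_sum n x) \<le> (\<Sum>i<n. sym_const * norm x)"
    unfolding partial_orbit_sum_def by (intro sum_norm_le norm_T_pow)
  then show ?thesis
    by (simp add: mult.assoc)
qed

lemma partial_orbit_sum_bounded_linear: "bounded_linear (partial_orbit_sum n)"
  by (rule bounded_linear_if_over[OF bounded_linear_overI[OF partial_orbit_sum_linear norm_partial_orbit_sum]])

lemma partial_orbit_sum_jump: "partial_orbit_sum n (jump j) = bump j - (T ^^ n) (bump j)"
proof -
  have "partial_orbit_sum n (jump j) = (\<Sum>i<n. (T ^^ i) (bump j) - (T ^^ Suc i) (bump j))"
    unfolding partial_orbit_sum_def jump_def linear_diff[OF T_pow_linear] funpow_Suc_right by simp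
  then show ?thesis
    using sum_lessThan_telescope'[of "\<lambda>i. (T ^^ i) (bump j)" n] by simp
qed

definition g :: 'a where "g = (\<Sum>j. jump j)"

definition h :: 'a where "h = (\<Sum>j. s (\<tau> j) (jump j))"

lemma coef_gh:
  assumes "i = i0 \<or> i = i1"
  shows "coef g i = 0" "coef h i = 0"
proof -
  have bl: "bounded_linear (\<lambda>z. coef z i)"
    by (rule bounded_linear_if_over_functional[OF bounded_linear_over_coef])
  have "coef (jump j) i = 0" for j
    using coef_bump[OF assms, of 0 j] coef_bump[OF assms, of 1 j]
    by (simp add: jump_def linear_diff[OF bounded_linear.linear[OF bl]])
  then show "coef g i = 0" "coef h i = 0"
    unfolding g_def h_def bounded_linear.suminf[OF bl summable_jump(1)]
      bounded_linear.suminf[OF bl summable_jump(2)]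
    by (simp_all add: coef_scale)
qed

text \<open>
  The plateau of cycle \<open>j\<close> sees only \<open>bump j - T^n (bump j)\<close>, and of this difference only the first term.
\<close>

lemma norm_partial_orbit_sum_g:
  assumes "3 * L j \<le> n" "n + 3 * L j \<le> q j"
  shows "M j \<le> sym_const * norm (partial_orbit_sum n g)"
proof -
  have "plateau_projection j (partial_orbit_sum n (jump i))
      = (if i = j then plateau_projection j (bump j) else 0)" for i
    using plateau_projection_T_pow_bump[of i j n] plateau_projection_T_pow_bump[of i j 0] assms
    by (auto simp: partial_orbit_sum_jump linear_diff[OF plateau_projection_linear])
  moreover have "(\<lambda>i. plateau_projection j (partial_orbit_sum n (jump i))) sums
      plateau_projection j (partial_orbit_sum n g)"
    unfolding g_def
    by (intro bounded_linear.sums[OF plateau_projection_bounded_linear]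
        bounded_linear.sums[OF partial_orbit_sum_bounded_linear] summable_sums summable_jump)
  ultimately have "plateau_projection j (partial_orbit_sum n g) = plateau_projection j (bump j)"
    using sums_unique2[OF _ sums_single[of j "\<lambda>_. plateau_projection j (bump j)"]] by simp
  then have "norm (plateau_projection j (partial_orbit_sum n g)) = M j"
    using plateau_nonzero[of j] M_ge_1[of j] by (simp add: plateau_projection_bump)
  then show ?thesis
    using norm_coordinate_projection[of "ix j ` {L j..<2 * L j}" "partial_orbit_sum n g"]
    by (simp add: plateau_projection_def)
qed

text \<open>
  Every large \<open>n\<close> lies between \<open>3 L_j\<close> and \<open>3 L_(j+1)\<close> for a large \<open>j\<close>, and there the displacement is at least
  of the order \<open>M_j\<close>.
\<close>

lemma partial_orbit_sum_g_at_top: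
  "filterlim (\<lambda>n. norm (partial_orbit_sum n g)) at_top sequentially"
  unfolding filterlim_at_top
proof
  fix B
  obtain J where J: "\<And>j. j \<ge> J \<Longrightarrow> sym_const * B \<le> M j"
    using M_at_top unfolding filterlim_at_top eventually_sequentially by meson
  have "B \<le> norm (partial_orbit_sum n g)" if n: "n \<ge> 3 * L J" for n
  proof -
    define j where "j = (LEAST i. i \<ge> J \<and> n < 3 * L (Suc i))"
    have "n + J \<ge> J \<and> n < 3 * L (Suc (n + J))"
      using strict_mono_imp_increasing[OF L_strict_mono, of "Suc (n + J)"] by simp
    from LeastI[of "\<lambda>i. i \<ge> J \<and> n < 3 * L (Suc i)", OF this, folded j_def]
    have j: "j \<ge> J" "n < 3 * L (Suc j)"
      by simp_all
    have "3 * L j \<le> n"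
    proof (cases "j = J")
      case False
      then obtain i where i: "j = Suc i" "i \<ge> J"
        using j(1) by (cases j) auto
      then have "\<not> (i \<ge> J \<and> n < 3 * L (Suc i))"
        using not_less_Least[of i "\<lambda>i. i \<ge> J \<and> n < 3 * L (Suc i)"] unfolding j_def[symmetric] by simp
      then show ?thesis
        using i by simp
    qed (use n in simp)
    moreover have "n + 3 * L j \<le> q j"
      using j(2) L_double[of j] by linarith
    ultimately have "sym_const * B \<le> sym_const * norm (partial_orbit_sum n g)"
      using norm_partial_orbit_sum_g J[OF j(1)] by (meson order.trans)
    then show ?thesis
      using sym_const_ge_1 by simp
  qed
  then show "\<forall>\<^sub>F n in sequentially. B \<le> norm (partial_orbit_sum n g)"
    unfolding eventually_sequentially by blast
qed

text \<open>
  Since \<open>r g + h\<close> is the sum of \<open>(r + \<tau>_j) jump_j\<close>, three ranges of \<open>j\<close> matter at time \<open>q k\<close>: the cycles up to \<open>k\<close>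
  have returned; cycle \<open>k + 1\<close> is fully displaced and contributes about \<open>M_(k+1) |r + \<tau>_(k+1)|\<close>; the
  flatness of the later bumps leaves a geometric tail.
\<close>

lemma norm_partial_orbit_sum_combination:
  "norm (partial_orbit_sum (q k) (s r g + h))
     \<le> bump_const * (1 + sym_const) * (M (Suc k) * norm (r + \<tau> (Suc k)))
       + 16 * sym_const * bump_const * (1 + norm r) * (1/2) ^ Suc k"
proof -
  define x where "x = (\<lambda>j. s (r + \<tau> j) (partial_orbit_sum (q k) (jump j)))"
  have "(\<lambda>j. partial_orbit_sum (q k) (s r (jump j) + s (\<tau> j) (jump j))) sums
      partial_orbit_sum (q k) (s r g + h)"
    unfolding g_def h_def
    by (intro bounded_linear.sums[OF partial_orbit_sum_bounded_linear] sums_add summable_sums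
        bounded_linear.sums[OF bounded_linear_if_over[OF bounded_linear_over_scale]] summable_jump)
  then have sums: "x sums partial_orbit_sum (q k) (s r g + h)"
    unfolding x_def by (simp add: partial_orbit_sum_linear scale_left_distrib)
  have x_zero: "x j = 0" if "j \<le> k" for j
    using T_pow_bump_return[OF q_dvd[OF that]] by (simp add: x_def partial_orbit_sum_jump)
  have x_first: "norm (x (Suc k)) \<le> bump_const * (1 + sym_const) * (M (Suc k) * norm (r + \<tau> (Suc k)))"
  proof -
    have "norm (partial_orbit_sum (q k) (jump (Suc k)))
        \<le> norm (bump (Suc k)) + sym_const * norm (bump (Suc k))"
      unfolding partial_orbit_sum_jump
      using norm_triangle_ineq4 norm_T_pow by (meson add_left_mono order.trans)
    also have "\<dots> \<le> (1 + sym_const) * (bump_const * M (Suc k))"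
      using mult_left_mono[OF norm_bump[of "Suc k"], of "1 + sym_const"] sym_const_ge_1
      by (simp add: algebra_simps)
    finally have "norm (r + \<tau> (Suc k)) * norm (partial_orbit_sum (q k) (jump (Suc k)))
        \<le> norm (r + \<tau> (Suc k)) * ((1 + sym_const) * (bump_const * M (Suc k)))"
      by (rule mult_left_mono) simp
    then show ?thesis
      by (simp add: x_def norm_scale mult_ac)
  qed
  define C where "C = 16 * sym_const * bump_const * (1 + norm r)"
  have x_tail: "norm (x (Suc j)) \<le> C * (1/2) ^ Suc j" if "k < j" for j
  proof -
    define X where "X = 2 * bump_const * M (Suc j) / real (L (Suc j))"
    have X: "0 \<le> X"
      using sym_const_ge_1 M_ge_1[of "Suc j"] by (simp add: X_def)
    have "norm (r + \<tau> (Suc j)) \<le> (1 + norm r) * (1 + norm (\<tau> (Suc j)))"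
      using norm_triangle_ineq[of r "\<tau> (Suc j)"] mult_nonneg_nonneg[OF norm_ge_zero norm_ge_zero, of r "\<tau> (Suc j)"]
      by (simp only: ring_distribs mult_1_left mult_1_right)
    moreover have "norm (partial_orbit_sum (q k) (jump (Suc j))) \<le> real (q k) * sym_const * X"
      using norm_bump_diff[of "Suc j"] sym_const_ge_1 unfolding jump_def X_def
      by (intro order.trans[OF norm_partial_orbit_sum] mult_left_mono) auto
    moreover have "real (q k) * sym_const * X \<le> 8 * real (L j) * sym_const * X"
      using that X sym_const_ge_1 L_mono[of "Suc k" j] by (intro mult_right_mono) auto
    ultimately have "norm (x (Suc j)) \<le> (1 + norm r) * (1 + norm (\<tau> (Suc j))) * (8 * real (L j) * sym_const * X)"
      unfolding x_def norm_scale by (intro mult_mono) (auto intro: order.trans)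
    also have "\<dots> = C * (M (Suc j) * (1 + norm (\<tau> (Suc j))) * real (L j) / real (L (Suc j)))"
      by (simp add: C_def X_def mult_ac)
    also have "\<dots> \<le> C * (1/2) ^ Suc j"
    proof (rule mult_left_mono)
      show "M (Suc j) * (1 + norm (\<tau> (Suc j))) * real (L j) / real (L (Suc j)) \<le> (1/2) ^ Suc j"
        using L_Suc[of j] L_pos[of "Suc j"] unfolding power_one_over by (simp add: field_simps)
      show "0 \<le> C"
        using sym_const_ge_1 by (simp add: C_def)
    qed
    finally show ?thesis .
  qed
  have geom: "(\<lambda>i. C * (1/2) ^ (i + (k + 2))) sums (C * (1/2) ^ Suc k)"
    using sums_mult[OF geometric_sums[of "1/2::real"], of "C * (1/2) ^ (k + 2)"]
    by (simp add: power_add mult_ac)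
  have tail: "norm (x (i + (k + 2))) \<le> C * (1/2) ^ (i + (k + 2))" for i
    using x_tail[of "Suc (i + k)"] by simp
  have "norm (\<Sum>i. x (i + (k + 2))) \<le> (\<Sum>i. C * (1/2) ^ (i + (k + 2)))"
    using tail sums_summable[OF geom] by (rule norm_suminf_le)
  also have "\<dots> = C * (1/2) ^ Suc k"
    using geom by (rule sums_unique[symmetric])
  finally have rest: "norm (\<Sum>i. x (i + (k + 2))) \<le> C * (1/2) ^ Suc k" .
  have "suminf x = x (Suc k) + (\<Sum>i. x (i + (k + 2)))"
    using suminf_split_initial_segment[OF sums_summable[OF sums], of "k + 2"] x_zero by simp
  then have "norm (suminf x) \<le> norm (x (Suc k)) + norm (\<Sum>i. x (i + (k + 2)))"
    by (simp add: norm_triangle_ineq)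
  also have "\<dots> \<le> bump_const * (1 + sym_const) * (M (Suc k) * norm (r + \<tau> (Suc k))) + C * (1/2) ^ Suc k"
    by (rule add_mono[OF x_first rest])
  finally show ?thesis
    unfolding sums_unique[OF sums] C_def .
qed

lemma combination_returns:
  "\<exists>n. strict_mono n \<and> (\<forall>k. n k \<ge> 1) \<and> (\<forall>z. (\<lambda>k. (T ^^ n k) z) \<longlonglongrightarrow> z) \<and>
     (\<lambda>k. partial_orbit_sum (n k) (s r g + h)) \<longlonglongrightarrow> 0"
proof -
  obtain \<sigma> where \<sigma>: "strict_mono \<sigma>" "(\<lambda>i. M (\<sigma> i) * norm (r + \<tau> (\<sigma> i))) \<longlonglongrightarrow> 0"
    using scanning by blast
  \<comment> \<open>At time \<open>q (j - 1)\<close> block \<open>j\<close> is the first that has not returned, whence the shift by one.\<close>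
  define \<rho> where "\<rho> i = \<sigma> (Suc i) - 1" for i
  have Suc_\<rho>: "Suc (\<rho> i) = \<sigma> (Suc i)" for i
    using strict_mono_imp_increasing[OF \<sigma>(1), of "Suc i"] by (simp add: \<rho>_def)
  have \<rho>: "strict_mono \<rho>"
    unfolding strict_mono_def using \<sigma>(1) by (metis Suc_\<rho> Suc_less_eq strict_mono_less)
  have "strict_mono (\<lambda>k. q (\<rho> k))"
    using strict_mono_compose[OF q_strict_mono \<rho>] .
  moreover have "q (\<rho> k) \<ge> 1" for k
    using L_pos[of "Suc (\<rho> k)"] by simp
  moreover have "(\<lambda>k. (T ^^ q (\<rho> k)) z) \<longlonglongrightarrow> z" for z
    by (rule T_pow_returns[OF strict_mono_imp_increasing[OF \<rho>]])
  moreover have "(\<lambda>k. partial_orbit_sum (q (\<rho> k)) (s r g + h)) \<longlonglongrightarrow> 0"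
  proof (rule Lim_null_comparison[OF always_eventually[OF allI[OF norm_partial_orbit_sum_combination]]])
    have "(\<lambda>k. M (\<sigma> (Suc k)) * norm (r + \<tau> (\<sigma> (Suc k)))) \<longlonglongrightarrow> 0"
      using \<sigma>(2) by (rule LIMSEQ_Suc)
    moreover have "(\<lambda>k. (1/2::real) ^ Suc (\<rho> k)) \<longlonglongrightarrow> 0"
      unfolding Suc_\<rho>
      using LIMSEQ_Suc[OF LIMSEQ_subseq_LIMSEQ[OF LIMSEQ_realpow_zero[of "1/2"] \<sigma>(1)]]
      by (simp add: o_def)
    ultimately show "(\<lambda>k. bump_const * (1 + sym_const) * (M (Suc (\<rho> k)) * norm (r + \<tau> (Suc (\<rho> k))))
        + 16 * sym_const * bump_const * (1 + norm r) * (1/2) ^ Suc (\<rho> k)) \<longlonglongrightarrow> 0"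
      unfolding Suc_\<rho> by (intro tendsto_add_zero tendsto_mult_right_zero)
  qed
  ultimately show ?thesis
    by blast
qed

lemma escaping_operator:
  "\<exists>R. bounded_linear_over s s R \<and> escaping_set R \<noteq> {} \<and> nowhere_dense (escaping_set R) \<and>
     (\<forall>x. x \<notin> escaping_set R \<longrightarrow>
        (\<exists>r :: nat \<Rightarrow> nat. strict_mono r \<and> (\<forall>k. r k \<ge> 1) \<and>
           weakly_converges_to s (\<lambda>k. (R ^^ r k) x) x))"
proof (rule rank_two_perturbation_escapes[where \<alpha> = "\<lambda>z. coef z i0" and \<beta> = "\<lambda>z. coef z i1" and g = g and h = h
        and u = "e i0" and v = "e i1", OF T norm_T_pow
      bounded_linear_over_coef coef_T[OF \<pi>_fixed(1)] bounded_linear_over_coef coef_T[OF \<pi>_fixed(2)]])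
  show "coef g i0 = 0" "coef g i1 = 0" "coef h i0 = 0" "coef h i1 = 0"
    by (simp_all add: coef_gh)
  show "coef (e i0) i0 = 1" "coef (e i0) i1 = 0" "coef (e i1) i1 = 1"
    using \<pi>_fixed(3) by (simp_all add: coef_e)
  show "filterlim (\<lambda>n. norm (\<Sum>i<n. (T ^^ i) g)) at_top sequentially"
    using partial_orbit_sum_g_at_top unfolding partial_orbit_sum_def .
  show "\<exists>n. strict_mono n \<and> (\<forall>k. n k \<ge> 1) \<and> (\<forall>z. (\<lambda>k. (T ^^ n k) z) \<longlonglongrightarrow> z) \<and>
     (\<lambda>k. \<Sum>i<n k. (T ^^ i) (s r g + h)) \<longlonglongrightarrow> 0" for r
    using combination_returns[of r] unfolding partial_orbit_sum_def .
qed

end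

section \<open>Splitting the basis into cycles\<close>

text \<open>
  The disjoint union of the cycles and of two additional cycles of length one is countable and infinite,
  hence a copy of the natural numbers. The order of the basis is of no importance for a symmetric basis.
\<close>

lemma cyclic_partition_of_nat:
  fixes q :: "nat \<Rightarrow> nat"
  assumes q: "\<And>j. q j > 0"
  obtains \<pi> :: "nat \<Rightarrow> nat" and ix :: "nat \<Rightarrow> nat \<Rightarrow> nat" and i0 i1 :: nat
  where "bij \<pi>" "\<And>j t. t < q j \<Longrightarrow> \<pi> (ix j t) = ix j (Suc t mod q j)"
    and "\<pi> i0 = i0" "\<pi> i1 = i1" "i0 \<noteq> i1"
    and "\<And>j j' t t'. \<lbrakk>t < q j; t' < q j'; ix j t = ix j' t'\<rbrakk> \<Longrightarrow> j = j' \<and> t = t'"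
    and "\<And>j t. t < q j \<Longrightarrow> ix j t \<noteq> i0" "\<And>j t. t < q j \<Longrightarrow> ix j t \<noteq> i1"
    and "\<And>m. m = i0 \<or> m = i1 \<or> (\<exists>j t. t < q j \<and> m = ix j t)"
proof -
  \<comment> \<open>Cycles 0 and 1 are the fixed points; the cycle of length \<open>q j\<close> is number \<open>j + 2\<close>.\<close>
  define l where "l j = (if j < 2 then 1 else q (j - 2))" for j
  have l: "l j > 0" for j
    using q by (simp add: l_def)
  define I where "I = Sigma UNIV (\<lambda>j. {..<l j})"
  have "infinite I"
  proof
    assume "finite I"
    then have "finite (fst ` I)"
      by simp
    moreover have "j \<in> fst ` I" for j
      using l[of j] unfolding I_def by force
    ultimately show False
      by (metis finite_subset infinite_UNIV_nat subsetI)
  qed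
  have "countable I"
    by simp
  define encode where "encode = to_nat_on I"
  define decode where "decode = from_nat_into I"
  have bij_encode: "bij_betw encode I UNIV"
    unfolding encode_def using \<open>countable I\<close> \<open>infinite I\<close> by (rule to_nat_on_infinite)
  have bij_decode: "bij_betw decode UNIV I"
    unfolding decode_def using \<open>countable I\<close> \<open>infinite I\<close> by (rule bij_betw_from_nat_into)
  have decode_encode: "decode (encode x) = x" if "x \<in> I" for x
    unfolding encode_def decode_def using \<open>countable I\<close> that by (rule from_nat_into_to_nat_on)
  define rot where "rot = (\<lambda>(j, t). (j, Suc t mod l j))"
  have bij_rot: "bij_betw rot I I"
  proof (rule bij_betw_byWitness[where f' = "\<lambda>(j, t). (j, if t = 0 then l j - 1 else t - 1)"])
    show "\<forall>x\<in>I. (\<lambda>(j, t). (j, if t = 0 then l j - 1 else t - 1)) (rot x) = x"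
      by (auto simp: I_def rot_def mod_Suc)
    show "\<forall>x\<in>I. rot ((\<lambda>(j, t). (j, if t = 0 then l j - 1 else t - 1)) x) = x"
      using l by (auto simp: I_def rot_def)
    show "rot ` I \<subseteq> I"
      using l by (auto simp: I_def rot_def)
    show "(\<lambda>(j, t). (j, if t = 0 then l j - 1 else t - 1)) ` I \<subseteq> I"
      using l by (auto simp: I_def)
  qed
  have in_I: "(j, t) \<in> I \<longleftrightarrow> t < l j" for j t
    by (simp add: I_def)
  have \<pi>: "(encode \<circ> rot \<circ> decode) (encode (j, t)) = encode (j, Suc t mod l j)" if "t < l j" for j t
    using that by (simp add: decode_encode in_I rot_def)
  have encode_inj: "x = y" if "encode x = encode y" "x \<in> I" "y \<in> I" for x y
    using that bij_encode unfolding bij_betw_def by (auto dest: inj_onD)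
  show thesis
  proof
    show "bij (encode \<circ> rot \<circ> decode)"
      using bij_betw_trans[OF bij_decode bij_betw_trans[OF bij_rot bij_encode]] by (simp add: o_assoc)
    show "(encode \<circ> rot \<circ> decode) (encode (j + 2, t)) = encode (j + 2, Suc t mod q j)" if "t < q j" for j t
      using \<pi>[of t "j + 2"] that by (simp add: l_def)
    show "(encode \<circ> rot \<circ> decode) (encode (0, 0)) = encode (0, 0)" "(encode \<circ> rot \<circ> decode) (encode (1, 0)) = encode (1, 0)"
      using \<pi>[of 0 0] \<pi>[of 0 1] by (simp_all add: l_def)
    show "encode (0, 0) \<noteq> encode (1, 0)"
      using encode_inj[of "(0, 0)" "(1, 0)"] by (auto simp: in_I l_def)
    show "j = j' \<and> t = t'" if "t < q j" "t' < q j'" "encode (j + 2, t) = encode (j' + 2, t')" for j j' t t'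
      using encode_inj[OF that(3)] that by (auto simp: in_I l_def)
    show "encode (j + 2, t) \<noteq> encode (0, 0)" "encode (j + 2, t) \<noteq> encode (1, 0)" if "t < q j" for j t
      using encode_inj[of "(j + 2, t)" "(0, 0)"] encode_inj[of "(j + 2, t)" "(1, 0)"] that
      by (auto simp: in_I l_def)
    show "m = encode (0, 0) \<or> m = encode (1, 0) \<or> (\<exists>j t. t < q j \<and> m = encode (j + 2, t))" for m
    proof -
      obtain j t where jt: "m = encode (j, t)" "t < l j"
        using bij_encode unfolding bij_betw_def by (metis in_I imageE rangeI surj_pair)
      show ?thesis
      proof (cases "j < 2")
        case True
        then show ?thesis
          using jt by (auto simp: l_def less_2_cases_iff)
      next
        case False
        then obtain i where "j = i + 2"
          by (metis le_add_diff_inverse2 not_less)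
        then have "t < q i \<and> m = encode (i + 2, t)"
          using jt by (simp add: l_def)
        then show ?thesis
          by blast
      qed
    qed
  qed
qed

section \<open>Existence of the operator\<close>

lemma escaping_operator_from_scanning_sequence:
  fixes s :: "'k::real_normed_field \<Rightarrow> 'a::banach \<Rightarrow> 'a" and \<tau> :: "nat \<Rightarrow> 'k" and M :: "nat \<Rightarrow> real"
  assumes "banach_space_over s" and Y: "complemented_subspace s Y" and e: "symmetric_basis_of s Y e"
    and M: "\<And>j. M j \<ge> 1" "filterlim M at_top sequentially"
      "\<And>r. \<exists>\<sigma>. strict_mono \<sigma> \<and> (\<lambda>i. M (\<sigma> i) * norm (r + \<tau> (\<sigma> i))) \<longlonglongrightarrow> 0"
  shows "\<exists>R. bounded_linear_over s s R \<and> escaping_set R \<noteq> {} \<and> nowhere_dense (escaping_set R) \<and>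
     (\<forall>x. x \<notin> escaping_set R \<longrightarrow>
        (\<exists>r :: nat \<Rightarrow> nat. strict_mono r \<and> (\<forall>k. r k \<ge> 1) \<and>
           weakly_converges_to s (\<lambda>k. (R ^^ r k) x) x))"
proof -
  interpret banach_space_over s
    by fact
  obtain P where P: "bounded_linear_over s s P" "P \<circ> P = P" "range P = Y"
    using Y unfolding complemented_subspace_def by blast
  have Y': "closed Y" "module.subspace s Y"
    using Y unfolding complemented_subspace_def by blast+
  have basis: "schauder_basis_of s Y e"
    using e unfolding symmetric_basis_of_def by (rule conjunct1)
  obtain N where N: "equivalent_norm_on s Y N"
    and inv: "\<forall>x \<pi> \<theta>. summable (\<lambda>i. s (x i) (e i)) \<and> bij \<pi> \<and> (\<forall>i. norm (\<theta> i) = 1) \<longrightarrow>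
           summable (\<lambda>i. s (\<theta> i * x i) (e (\<pi> i))) \<and>
           N (\<Sum>i. s (x i) (e i)) = N (\<Sum>i. s (\<theta> i * x i) (e (\<pi> i)))"
    using conjunct2[OF e[unfolded symmetric_basis_of_def]] by (elim exE conjE)
  define D where "D j = nat \<lceil>M j * (1 + norm (\<tau> j))\<rceil>" for j
  have D: "M j * (1 + norm (\<tau> j)) \<le> real (D j)" for j
    unfolding D_def by (rule real_nat_ceiling_ge)
  have D_pos: "D j > 0" for j
  proof -
    have "0 < M j * (1 + norm (\<tau> j))"
      using M(1)[of j] by (intro mult_pos_pos add_pos_nonneg) auto
    then show ?thesis
      using D[of j] by (metis less_le_trans of_nat_0_less_iff)
  qed
  \<comment> \<open>A product, so that each length divides the next.\<close>
  define L where "L j = (\<Prod>i\<le>j. 2 ^ i * D i)" for j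
  have L_Suc: "L (Suc j) = L j * (2 ^ Suc j * D (Suc j))" for j
    by (simp add: L_def mult_ac)
  have q_pos: "8 * L (Suc j) > 0" for j
    using D_pos by (auto simp: L_def intro!: prod_pos)
  show ?thesis
  proof (rule cyclic_partition_of_nat[of "\<lambda>j. 8 * L (Suc j)", OF q_pos])
    fix \<pi> :: "nat \<Rightarrow> nat" and ix :: "nat \<Rightarrow> nat \<Rightarrow> nat" and i0 i1 :: nat
    assume blocks: "bij \<pi>"
      "\<And>j t. t < 8 * L (Suc j) \<Longrightarrow> \<pi> (ix j t) = ix j (Suc t mod (8 * L (Suc j)))"
      "\<pi> i0 = i0" "\<pi> i1 = i1" "i0 \<noteq> i1"
      "\<And>j j' t t'. \<lbrakk>t < 8 * L (Suc j); t' < 8 * L (Suc j'); ix j t = ix j' t'\<rbrakk> \<Longrightarrow> j = j' \<and> t = t'"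
      "\<And>j t. t < 8 * L (Suc j) \<Longrightarrow> ix j t \<noteq> i0" "\<And>j t. t < 8 * L (Suc j) \<Longrightarrow> ix j t \<noteq> i1"
      "\<And>m. m = i0 \<or> m = i1 \<or> (\<exists>j t. t < 8 * L (Suc j) \<and> m = ix j t)"
    interpret complemented_symmetric_basis s Y P e N
    proof
      show "P (P z) = P z" for z
        using fun_cong[OF P(2), of z] by simp
      show "summable (\<lambda>i. s (\<theta> i * x i) (e (\<pi> i))) \<and>
          N (\<Sum>i. s (x i) (e i)) = N (\<Sum>i. s (\<theta> i * x i) (e (\<pi> i)))"
        if "summable (\<lambda>i. s (x i) (e i))" "bij \<pi>" "\<And>i. norm (\<theta> i) = 1" for x \<pi> \<theta>
        using inv that by blast
    qed (fact P basis N Y')+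
    interpret cyclic_blocks s Y P e N \<tau> M L \<pi> ix i0 i1
    proof
      show "M 0 * (1 + norm (\<tau> 0)) \<le> real (L 0)"
        using D[of 0] by (simp add: L_def)
      show "M (Suc j) * (1 + norm (\<tau> (Suc j))) * 2 ^ Suc j * real (L j) \<le> real (L (Suc j))" for j
        using mult_right_mono[OF D[of "Suc j"], of "2 ^ Suc j * real (L j)"]
        by (simp add: L_Suc mult_ac)
      show "L j dvd L (Suc j)" for j
        by (simp add: L_Suc)
    qed (fact M blocks)+
    show ?thesis
      by (rule escaping_operator)
  qed
qed

text \<open>
  Real and complex scalars enter only through the compactness of balls, which the nets require.
\<close>

theorem escaping_operator_if_complemented_symmetric_basis:
  fixes s :: "'k::{real_normed_field, heine_borel} \<Rightarrow> 'a::banach \<Rightarrow> 'a"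
  assumes "banach_space_over s" "complemented_subspace s Y" "symmetric_basis_of s Y e"
  shows "\<exists>R. bounded_linear_over s s R \<and> escaping_set R \<noteq> {} \<and> nowhere_dense (escaping_set R) \<and>
     (\<forall>x. x \<notin> escaping_set R \<longrightarrow>
        (\<exists>r :: nat \<Rightarrow> nat. strict_mono r \<and> (\<forall>k. r k \<ge> 1) \<and>
           weakly_converges_to s (\<lambda>k. (R ^^ r k) x) x))"
  by (rule weighted_scanning_sequence) (rule escaping_operator_from_scanning_sequence[OF assms])

theorem mainTheorem2:
  fixes Y :: "'a::banach set"
    and scaleC :: "complex \<Rightarrow> 'b::banach \<Rightarrow> 'b"
    and W :: "'b set"
  shows
    "(complemented_subspace (*\<^sub>R) Y \<and> infinite_dimensional (*\<^sub>R) Y \<and>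
      (\<exists>e. symmetric_basis_of (*\<^sub>R) Y e) \<longrightarrow>
        (\<exists>R :: 'a \<Rightarrow> 'a. bounded_linear R \<and>
           escaping_set R \<noteq> {} \<and> nowhere_dense (escaping_set R) \<and>
           (\<forall>x. x \<notin> escaping_set R \<longrightarrow>
              (\<exists>r :: nat \<Rightarrow> nat. strict_mono r \<and> (\<forall>k. r k \<ge> 1) \<and>
                 weakly_converges_to (*\<^sub>R) (\<lambda>k. (R ^^ r k) x) x)))) \<and>
     (banach_space_over scaleC \<and>
      complemented_subspace scaleC W \<and> infinite_dimensional scaleC W \<and>
      (\<exists>e. symmetric_basis_of scaleC W e) \<longrightarrow>
        (\<exists>R :: 'b \<Rightarrow> 'b. bounded_linear_over scaleC scaleC R \<and>
           escaping_set R \<noteq> {} \<and> nowhere_dense (escaping_set R) \<and>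
           (\<forall>x. x \<notin> escaping_set R \<longrightarrow>
              (\<exists>r :: nat \<Rightarrow> nat. strict_mono r \<and> (\<forall>k. r k \<ge> 1) \<and>
                 weakly_converges_to scaleC (\<lambda>k. (R ^^ r k) x) x))))"
  using escaping_operator_if_complemented_symmetric_basis
      [OF banach_space_over_scaleR, unfolded bounded_linear_over_scaleR]
    escaping_operator_if_complemented_symmetric_basis[of scaleC]
  by (intro conjI impI; elim conjE exE; simp)

end
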